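(* For any circle graph $G$ on $n \ge 3$ vertices, $\psi(G) \le \lceil n/2 \rceil$.
   Context: A circle graph is the intersection graph of a finite set of chords of a circle. For $k \ge 3$, a $k$-polygon graph is the intersection graph of a finite set of chords of a convex $k$-sided polygon with each chord having its endpoints on two distinct sides; $2$-polygon graphs are the permutation graphs. The polygon number $\psi(G)$ of a circle graph $G$ is the minimum $k\ge 2$ such that $G$ is a $k$-polygon graph. *)

theory Defs
  imports "HOL-Analysis.Analysis" "HOL-Combinatorics.Permutations" "Graph_Theory.Graph_Theory"
begin

text \<open>
  A finite simple graph is a \<^locale>\<open>pair_graph\<close>: each undirected edge is the pair of its two
  opposite arcs. The Euclidean plane is the type \<^typ>\<open>complex\<close>.
\<close>

definition intersection_graph :: "'b set set \<Rightarrow> 'b set pair_pre_digraph" where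
  "intersection_graph S =
     \<lparr> pverts = S, parcs = {(A, B). A \<in> S \<and> B \<in> S \<and> A \<noteq> B \<and> A \<inter> B \<noteq> {}} \<rparr>"

definition graph_iso :: "'a pair_pre_digraph \<Rightarrow> 'b pair_pre_digraph \<Rightarrow> bool" where
  "graph_iso G H \<longleftrightarrow> digraph_iso (with_proj G) (with_proj H)"

definition circle_chord :: "complex \<Rightarrow> real \<Rightarrow> complex set \<Rightarrow> bool" where
  "circle_chord z r c \<longleftrightarrow>
     (\<exists>a b. a \<in> sphere z r \<and> b \<in> sphere z r \<and> a \<noteq> b \<and> c = closed_segment a b)"

definition circle_graph :: "'a pair_pre_digraph \<Rightarrow> bool" where
  "circle_graph G \<longleftrightarrow>
     (\<exists>z r S. r > 0 \<and> finite S \<and> (\<forall>c\<in>S. circle_chord z r c) \<and> graph_iso G (intersection_graph S))"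

definition convex_polygon :: "nat \<Rightarrow> complex set \<Rightarrow> bool" where
  "convex_polygon k P \<longleftrightarrow> polytope P \<and> aff_dim P = 2 \<and> card {s. s edge_of P} = k"

text \<open>
  Sides are closed segments, so a corner lies on two sides and may be an endpoint of a chord.
  Moving such endpoints slightly off the corners, in the order that keeps chords with a common
  endpoint crossing, shows that excluding corners would give the same class of graphs.
\<close>

definition polygon_chord :: "complex set \<Rightarrow> complex set \<Rightarrow> bool" where
  "polygon_chord P c \<longleftrightarrow>
     (\<exists>s t a b. s edge_of P \<and> t edge_of P \<and> s \<noteq> t \<and> a \<in> s \<and> b \<in> t \<and> a \<noteq> b
        \<and> c = closed_segment a b)"

definition inversion_graph :: "nat \<Rightarrow> (nat \<Rightarrow> nat) \<Rightarrow> nat pair_pre_digraph" where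
  "inversion_graph n p =
     \<lparr> pverts = {..<n},
       parcs = {(i, j). i < n \<and> j < n \<and> (i < j \<and> p j < p i \<or> j < i \<and> p i < p j)} \<rparr>"

definition permutation_graph :: "'a pair_pre_digraph \<Rightarrow> bool" where
  "permutation_graph G \<longleftrightarrow>
     (\<exists>n p. p permutes {..<n} \<and> graph_iso G (inversion_graph n p))"

definition polygon_graph :: "nat \<Rightarrow> 'a pair_pre_digraph \<Rightarrow> bool" where
  "polygon_graph k G \<longleftrightarrow>
     (if k = 2 then permutation_graph G
      else k \<ge> 3 \<and>
        (\<exists>P S. convex_polygon k P \<and> finite S \<and> (\<forall>c\<in>S. polygon_chord P c)
           \<and> graph_iso G (intersection_graph S)))"

definition polygon_number :: "'a pair_pre_digraph \<Rightarrow> nat" where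
  "polygon_number G = (LEAST k. k \<ge> 2 \<and> polygon_graph k G)"

end

theory Submission
  imports Defs
begin

text \<open>
  Represent \<open>G\<close> by \<open>2 n\<close> distinct endpoints on a circle and look for \<open>\<lceil>n / 2\<rceil>\<close> cut points such that both
  arcs of every chord contain a cut; the cuts become the corners of the polygon. An isolated vertex can
  be inserted around a cut and a twin next to its twin, so suppose that there are none. Then every arc
  of a chord that is neither pendant nor the support of a pendant contains at least two further
  endpoints, and without pendants a cut at every fourth endpoint works. In general a support and its
  pendant pay together for one cut at one end of the support, and the pendant, which crosses nothing
  else, may be moved to whichever end of the support is cut. The choice between the two ends is left
  open by letting an end of a support be used for the other chords at half price: a support used at one
  end costs nothing extra, and a support used at both ends costs one cut extra. With these prices a
  left-to-right greedy stabbing of the remaining chords needs no more than their number divided by two.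
\<close>

text \<open>Accounting is in tokens, one per endpoint of a chord in \<open>N\<close>. A budget of
  \<open>k\<close> cuts for \<open>2 * k\<close> vertices is one cut for every four endpoints, hence
  the prices four and two. The obstacle is that the interval ending first may release only three
  tokens. A stab at a support end inside it leaves one token over but misses intervals that begin
  behind it; a stab at its right end is one token too dear. Neither can be chosen on the spot, so
  the induction also carries a disjunction: cover more at the price of one extra token, or save one.
  Two further devices make the count close. A cut at the leftmost endpoint serves the outer arcs of
  all chords in \<open>N\<close> at once, which turns a problem on arcs into one on intervals; it
  overdraws the budget by half a cut, and integrality absorbs this. Cuts are first placed at
  endpoints, where they count for both arcs: distinct chords have distinct ends, so each such cut
  can later be pushed off in the direction that its own chord needs, given that some other cut
  exists, hence \<open>2 \<le> k\<close>.\<close>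

section \<open>Stabbing intervals at two prices\<close>

locale weighted_intervals =
  fixes A B :: "real set" and J :: "(real \<times> real) set"
  assumes finite_A: "finite A" and finite_B: "finite B" and A_B: "A \<inter> B = {}"
    and J_less: "\<And>a b. (a, b) \<in> J \<Longrightarrow> a < b"
    and J_subset: "J \<subseteq> A \<times> A"
    and J_right: "\<And>a a' b. (a, b) \<in> J \<Longrightarrow> (a', b) \<in> J \<Longrightarrow> a = a'"
    and J_left_right: "\<And>a b c. (a, b) \<in> J \<Longrightarrow> (b, c) \<notin> J"
    and J_inner: "\<And>a b. (a, b) \<in> J \<Longrightarrow> 2 \<le> card ((A \<union> B) \<inter> {a<..<b})"
begin

text \<open>
  Every point of \<open>A\<close> contributes one token. A stab at a point of \<open>A\<close> costs four tokens, one at a point of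
  \<open>B\<close> two.
\<close>
definition cost :: "real set \<Rightarrow> nat" where
  "cost Z = 4 * card (Z \<inter> A) + 2 * card (Z \<inter> B)"

text \<open>The tokens not yet spent when a sweep from the left has reached
  \<open>y\<close>.\<close>

definition rest :: "real \<Rightarrow> nat" where
  "rest y = card (A \<inter> {y<..})"

definition stabs :: "real set \<Rightarrow> real \<Rightarrow> bool" where
  "stabs Z y \<longleftrightarrow> Z \<subseteq> A \<union> B \<and> (\<forall>(a, b)\<in>J. y < a \<longrightarrow> Z \<inter> {a..b} \<noteq> {})"

text \<open>As in classical interval stabbing: every interval that begins after \<open>y\<close> and
  no later than \<open>b\<close> contains \<open>b\<close>.\<close>

definition first_ending :: "real \<Rightarrow> real \<Rightarrow> real \<Rightarrow> bool" where
  "first_ending y a b \<longleftrightarrow> (a, b) \<in> J \<and> y < a \<and> (\<forall>(a', b')\<in>J. y < a' \<longrightarrow> b \<le> b')"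

section \<open>The greedy sweep\<close>

lemma finite_J: "finite J"
  using J_subset finite_A by (meson finite_SigmaI finite_subset)

lemma first_ending_exists:
  assumes "(a, b) \<in> J" "y < a"
  shows "\<exists>a b. first_ending y a b"
proof -
  let ?S = "{p \<in> J. y < fst p}"
  have fin: "finite ?S" and ne: "?S \<noteq> {}"
    using finite_J assms by auto
  define p where "p = arg_min_on snd ?S"
  have "p \<in> ?S"
    using arg_min_if_finite(1)[OF fin ne] by (simp add: p_def)
  moreover have "snd p \<le> snd q" if "q \<in> ?S" for q
    using arg_min_least[OF fin ne that] by (simp add: p_def)
  ultimately have "first_ending y (fst p) (snd p)"
    by (force simp: first_ending_def)
  thus ?thesis by blast
qed

lemma rest_split:
  assumes "y \<le> b"
  shows "rest y = card (A \<inter> {y<..b}) + rest b"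
proof -
  have "A \<inter> {y<..} = (A \<inter> {y<..b}) \<union> (A \<inter> {b<..})"
    using assms by auto
  moreover have "(A \<inter> {y<..b}) \<inter> (A \<inter> {b<..}) = {}"
    by auto
  ultimately show ?thesis
    unfolding rest_def using finite_A by (simp add: card_Un_disjoint)
qed

lemma cost_insert_A: "a \<in> A \<Longrightarrow> Z \<subseteq> A \<union> B \<Longrightarrow> cost (insert a Z) \<le> 4 + cost Z"
  and cost_insert_B: "a \<in> B \<Longrightarrow> Z \<subseteq> A \<union> B \<Longrightarrow> cost (insert a Z) \<le> 2 + cost Z"
  using A_B finite_A finite_B
  by (auto simp: cost_def Int_insert_left card_insert_if)

lemma stabs_insert:
  assumes "stabs Z m" "c \<in> A \<union> B"
    and "\<And>a b. (a, b) \<in> J \<Longrightarrow> y < a \<Longrightarrow> a \<le> m \<Longrightarrow> a \<le> c \<and> c \<le> b"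
  shows "stabs (insert c Z) y"
  using assms unfolding stabs_def by fastforce

lemma stabs_empty: "(\<nexists>a b. first_ending y a b) \<Longrightarrow> stabs {} y"
  using first_ending_exists by (force simp: stabs_def)

lemma stab_right_end:
  assumes "first_ending y a b" "stabs Z b" "4 + cost Z \<le> t"
  shows "\<exists>Z. stabs Z y \<and> cost Z \<le> t"
proof (intro exI conjI)
  show "stabs (insert b Z) y"
    using assms J_subset by (intro stabs_insert[of Z b]) (auto simp: first_ending_def)
  have "b \<in> A" using assms J_subset by (auto simp: first_ending_def)
  thus "cost (insert b Z) \<le> t"
    using cost_insert_A[of b Z] assms by (auto simp: stabs_def)
qed

text \<open>The sweep restarts at \<open>c\<close> and not at \<open>b\<close>, because intervals
  that begin between \<open>c\<close> and \<open>b\<close> are not hit.\<close>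

lemma stab_inner:
  assumes "first_ending y a b" "c \<in> B" "a < c" "c < b" "stabs Z c" "2 + cost Z \<le> t"
  shows "\<exists>Z. stabs Z y \<and> cost Z \<le> t"
proof (intro exI conjI)
  show "stabs (insert c Z) y"
    using assms by (intro stabs_insert[of Z c]) (fastforce simp: first_ending_def)+
  show "cost (insert c Z) \<le> t"
    using cost_insert_B[of c Z] assms by (auto simp: stabs_def)
qed

text \<open>No interval begins at a right end, so if \<open>b\<close> is the only point of
  \<open>A\<close> in the gap, nothing begins there and the sweep may be taken to restart at
  \<open>c\<close>.\<close>

lemma stabs_mono_start:
  assumes "stabs Z b" "c \<le> b" "\<And>a'. a' \<in> A \<Longrightarrow> c < a' \<Longrightarrow> a' \<le> b \<Longrightarrow> a' = b" "(a, b) \<in> J"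
  shows "stabs Z c"
proof -
  have "b < x" if "(x, z) \<in> J" "c < x" for x z
  proof (rule ccontr)
    assume "\<not> b < x"
    hence "x = b" using assms(3)[of x] that J_subset by auto
    thus False using J_left_right[OF assms(4)] that by simp
  qed
  thus ?thesis using assms(1) unfolding stabs_def by blast
qed

text \<open>
  The second conjunct carries a choice through the induction: when the first interval to end has only
  three tokens and its last point of \<open>B\<close>, at \<open>m'\<close>, is followed by one more point of \<open>A\<close>, it is decided only
  later whether to stab at \<open>m'\<close> (two tokens, later intervals starting before \<open>y\<close> stay open) or at the right
  end \<open>y\<close> (four tokens).
\<close>
lemma stabs_exist:
  "(\<exists>Z. stabs Z y \<and> cost Z \<le> rest y) \<and>
   (\<forall>m'\<le>y. (\<forall>(a, b)\<in>J. m' < a \<longrightarrow> y < b) \<longrightarrow>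
      (\<exists>Z. stabs Z m' \<and> cost Z \<le> rest y + 1) \<or> (\<exists>Z. stabs Z y \<and> cost Z + 1 \<le> rest y))"
proof (induction "rest y" arbitrary: y rule: less_induct)
  case less
  have IH1: "\<exists>Z. stabs Z b \<and> cost Z \<le> rest b" if "rest b < rest y" for b
    using less[OF that] by blast
  \<comment> \<open>Right ends are distinct, so an interval that begins after \<open>c\<close> ends
    strictly after \<open>b\<close>; this is the premise of the second conjunct at
    \<open>b\<close>.\<close>
  have IH2: "(\<exists>Z. stabs Z c \<and> cost Z \<le> rest b + 1) \<or> (\<exists>Z. stabs Z b \<and> cost Z + 1 \<le> rest b)"
    if "rest b < rest y" "first_ending z a b" "c \<le> b" "a \<le> c" "z \<le> c" for z a b c
  proof -
    have "\<forall>(a', b')\<in>J. c < a' \<longrightarrow> b < b'"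
    proof safe
      fix a' b' assume *: "(a', b') \<in> J" "c < a'"
      hence "b \<le> b'" using that by (fastforce simp: first_ending_def)
      moreover have "b \<noteq> b'" using J_right[of a b a'] * that by (auto simp: first_ending_def)
      ultimately show "b < b'" by simp
    qed
    thus ?thesis using less[OF that(1)] that(3) by blast
  qed
  have fe: "a \<in> A" "b \<in> A" "a < b" "z < a" "(a, b) \<in> J" if "first_ending z a b" for z a b
    using that J_subset J_less by (auto simp: first_ending_def)
  show ?case
  proof (intro conjI allI impI)
    show "\<exists>Z. stabs Z y \<and> cost Z \<le> rest y"
    proof (cases "\<exists>a b. first_ending y a b")
      case False
      thus ?thesis using stabs_empty by (intro exI[of _ "{}"]) (auto simp: cost_def)
    next
      case True
      then obtain a b where ab: "first_ending y a b" by blast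
      note f = fe[OF ab]
      let ?T = "A \<inter> {y<..b}"
      have split: "rest y = card ?T + rest b"
        using f by (intro rest_split) auto
      have two: "card {a, b} \<le> card ?T"
        using f finite_A by (intro card_mono) auto
      hence two: "2 \<le> card ?T" using f by simp
      hence lt: "rest b < rest y" using split by simp
      then obtain Z where Z: "stabs Z b" "cost Z \<le> rest b" using IH1 by blast
      show ?thesis
      proof (cases "4 \<le> card ?T")
        case True
        thus ?thesis using stab_right_end[OF ab Z(1)] Z(2) split by auto
      next
        case False
        let ?C = "B \<inter> {a<..<b}"
        have sub: "insert a (insert b (A \<inter> {a<..<b})) \<subseteq> ?T" using f by auto
        have "card (insert a (insert b (A \<inter> {a<..<b}))) = 2 + card (A \<inter> {a<..<b})"
          using f finite_A by simp
        hence in1: "2 + card (A \<inter> {a<..<b}) \<le> card ?T"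
          using card_mono[OF _ sub] finite_A by simp
        \<comment> \<open>At most three tokens, two of them \<open>a\<close> and \<open>b\<close>,
          leave at most one point of \<open>A\<close> strictly inside; the second inner point must
          be in \<open>B\<close>.\<close>
        have "?C \<noteq> {}"
        proof
          assume "?C = {}"
          hence "(A \<union> B) \<inter> {a<..<b} = A \<inter> {a<..<b}" by auto
          thus False using J_inner[OF f(5)] in1 False by simp
        qed
        define c where "c = Max ?C"
        have c: "c \<in> B" "a < c" "c < b"
          using Max_in[of ?C] \<open>?C \<noteq> {}\<close> finite_B by (auto simp: c_def)
        have cmax: "x \<le> c" if "x \<in> B" "a < x" "x < b" for x
          using that finite_B by (auto simp: c_def)
        show ?thesis
        proof (cases "A \<inter> {c<..<b} = {}")
          case True
          have "stabs Z c"
            using True c by (intro stabs_mono_start[OF Z(1) _ _ f(5)]) fastforce+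
          thus ?thesis
            using stab_inner[OF ab c, of Z] Z two split by auto
        next
          case r: False
          then obtain r where r: "r \<in> A" "c < r" "r < b" by auto
          have "card {a, r, b} \<le> card ?T"
            using f r c finite_A by (intro card_mono) auto
          hence three: "card ?T = 3" using False f r c by simp
          \<comment> \<open>With three tokens, a stab at \<open>c\<close> leaves one token to the
            remaining sweep and a stab at \<open>b\<close> borrows one from it. The second conjunct
            offers exactly these two alternatives.\<close>
          from IH2[OF lt ab] c f have
            "(\<exists>Z. stabs Z c \<and> cost Z \<le> rest b + 1) \<or> (\<exists>Z. stabs Z b \<and> cost Z + 1 \<le> rest b)"
            by simp
          thus ?thesis
          proof (elim disjE exE conjE)
            fix Z assume "stabs Z c" "cost Z \<le> rest b + 1"
            thus ?thesis using stab_inner[OF ab c] split three by simp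
          next
            fix Z assume "stabs Z b" "cost Z + 1 \<le> rest b"
            thus ?thesis using stab_right_end[OF ab] split three by simp
          qed
        qed
      qed
    qed
  next
    fix m assume m: "m \<le> y" and none: "\<forall>(a, b)\<in>J. m < a \<longrightarrow> y < b"
    show "(\<exists>Z. stabs Z m \<and> cost Z \<le> rest y + 1) \<or> (\<exists>Z. stabs Z y \<and> cost Z + 1 \<le> rest y)"
    proof (cases "\<exists>a b. first_ending m a b")
      case False
      thus ?thesis using stabs_empty by (intro disjI1 exI[of _ "{}"]) (auto simp: cost_def)
    next
      case True
      then obtain a b where ab: "first_ending m a b" by blast
      note f = fe[OF ab]
      have yb: "y < b" using none f by auto
      let ?T = "A \<inter> {y<..b}"
      have split: "rest y = card ?T + rest b"
        using yb by (intro rest_split) auto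
      have "card {b} \<le> card ?T"
        using f yb finite_A by (intro card_mono) auto
      hence one: "1 \<le> card ?T" by simp
      hence lt: "rest b < rest y" using split by simp
      then obtain Z where Z: "stabs Z b" "cost Z \<le> rest b" using IH1 by blast
      \<comment> \<open>With one token of overdraft, three pay for a stab at \<open>b\<close>. A
        single one is \<open>b\<close> itself, so nothing begins before \<open>b\<close> and the
        token is saved. With two, the choice is handed on to \<open>b\<close> if the interval is
        already open at \<open>y\<close>; otherwise a point of \<open>B\<close> lies inside
        it.\<close>
      consider "3 \<le> card ?T" | "card ?T = 1" | "card ?T = 2" "a \<le> y" | "card ?T = 2" "y < a"
        using one by linarith
      thus ?thesis
      proof cases
        case 1
        thus ?thesis using stab_right_end[OF ab Z(1)] Z(2) split by auto
      next
        case 2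
        have "?T = {b}"
          using f yb finite_A 2 by (metis Int_iff card_1_singletonE greaterThanAtMost_iff order_refl singletonD)
        hence "stabs Z y"
          using yb by (intro stabs_mono_start[OF Z(1) _ _ f(5)]) fastforce+
        thus ?thesis using Z 2 split by auto
      next
        case 3
        from IH2[OF lt ab _ 3(2) m] yb have
          "(\<exists>Z. stabs Z y \<and> cost Z \<le> rest b + 1) \<or> (\<exists>Z. stabs Z b \<and> cost Z + 1 \<le> rest b)"
          by simp
        thus ?thesis
        proof (elim disjE exE conjE)
          fix Z assume "stabs Z y" "cost Z \<le> rest b + 1"
          thus ?thesis using split 3 by (intro disjI2 exI[of _ Z]) simp
        next
          fix Z assume "stabs Z b" "cost Z + 1 \<le> rest b"
          thus ?thesis using stab_right_end[OF ab] split 3 by simp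
        qed
      next
        case 4
        have "{a, b} = ?T"
        proof (rule card_subset_eq)
          show "finite ?T" using finite_A by blast
          show "{a, b} \<subseteq> ?T" using f 4(2) yb by auto
          show "card {a, b} = card ?T" using f(3) 4(1) by simp
        qed
        hence only: "x = a \<or> x = b" if "x \<in> A" "y < x" "x \<le> b" for x
        proof -
          have "x \<in> ?T" using that by simp
          hence "x \<in> {a, b}" using \<open>{a, b} = ?T\<close> by metis
          thus ?thesis by simp
        qed
        have "(A \<union> B) \<inter> {a<..<b} \<noteq> {}"
          using J_inner[OF f(5)] by auto
        then obtain c where "c \<in> (A \<union> B) \<inter> {a<..<b}"
          by (meson all_not_in_conv)
        hence c: "c \<in> B" "a < c" "c < b"
          using only[of c] 4 by auto
        have "x = b" if "x \<in> A" "c < x" "x \<le> b" for x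
          using only[OF that(1)] that c 4 by linarith
        hence "stabs Z c"
          using c by (intro stabs_mono_start[OF Z(1) _ _ f(5)]) auto
        thus ?thesis using stab_inner[OF ab c, of Z] Z split 4 by auto
      qed
    qed
  qed
qed

theorem stabbing_set:
  "\<exists>Z. Z \<subseteq> A \<union> B \<and> (\<forall>(a, b)\<in>J. Z \<inter> {a..b} \<noteq> {}) \<and> 2 * card (Z \<inter> A) + card (Z \<inter> B) \<le> card A div 2"
proof -
  \<comment> \<open>\<open>insert 0\<close> keeps \<open>Min\<close> meaningful when
    \<open>A\<close> is empty; \<open>y\<close> only has to lie to the left of
    \<open>A\<close>.\<close>
  define y where "y = Min (insert 0 A) - 1"
  have y: "y < a" if "a \<in> A" for a
  proof -
    have "Min (insert 0 A) \<le> a" using that finite_A by simp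
    thus ?thesis by (simp add: y_def)
  qed
  hence "A \<inter> {y<..} = A" by auto
  hence "rest y = card A" by (simp add: rest_def)
  with stabs_exist[of y] obtain Z where Z: "stabs Z y" "cost Z \<le> card A" by auto
  have "y < a" if "(a, b) \<in> J" for a b using y that J_subset by auto
  hence "\<forall>(a, b)\<in>J. Z \<inter> {a..b} \<noteq> {}"
    using Z(1) unfolding stabs_def by blast
  moreover have "2 * card (Z \<inter> A) + card (Z \<inter> B) \<le> card A div 2"
    using Z(2) unfolding cost_def by linarith
  ultimately show ?thesis
    using Z(1) unfolding stabs_def by blast
qed

end

section \<open>Chord diagrams and cuts\<close>

definition chord_diagram :: "'a set \<Rightarrow> ('a \<Rightarrow> real) \<Rightarrow> ('a \<Rightarrow> real) \<Rightarrow> bool" where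
  "chord_diagram V l r \<longleftrightarrow>
     (\<forall>v\<in>V. l v < r v) \<and> inj_on l V \<and> inj_on r V \<and> l ` V \<inter> r ` V = {}"

definition crosses :: "('a \<Rightarrow> real) \<Rightarrow> ('a \<Rightarrow> real) \<Rightarrow> 'a \<Rightarrow> 'a \<Rightarrow> bool" where
  "crosses l r u v \<longleftrightarrow>
     l u < l v \<and> l v < r u \<and> r u < r v \<or> l v < l u \<and> l u < r v \<and> r v < r u"

definition represents :: "'a set \<Rightarrow> ('a \<Rightarrow> 'a \<Rightarrow> bool) \<Rightarrow> ('a \<Rightarrow> real) \<Rightarrow> ('a \<Rightarrow> real) \<Rightarrow> bool" where
  "represents V E l r \<longleftrightarrow>
     chord_diagram V l r \<and> (\<forall>u\<in>V. \<forall>v\<in>V. u \<noteq> v \<longrightarrow> (E u v \<longleftrightarrow> crosses l r u v))"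

text \<open>The circle is cut open to a line, so the second arc of a chord is all that lies outside
  its interval. A cut on each arc puts the two ends on different sides of the polygon.\<close>

definition separates :: "real set \<Rightarrow> 'a set \<Rightarrow> ('a \<Rightarrow> real) \<Rightarrow> ('a \<Rightarrow> real) \<Rightarrow> bool" where
  "separates X V l r \<longleftrightarrow> X \<inter> (l ` V \<union> r ` V) = {} \<and>
     (\<forall>v\<in>V. (\<exists>x\<in>X. l v < x \<and> x < r v) \<and> (\<exists>x\<in>X. x < l v \<or> r v < x))"

definition cuttable :: "'a set \<Rightarrow> ('a \<Rightarrow> 'a \<Rightarrow> bool) \<Rightarrow> nat \<Rightarrow> bool" where
  "cuttable V E k \<longleftrightarrow>
     (\<exists>l r X. represents V E l r \<and> finite X \<and> card X = k \<and> separates X V l r)"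

section \<open>Elementary facts on chord diagrams\<close>

lemma chord_diagram_iff:
  "chord_diagram V l r \<longleftrightarrow>
     (\<forall>u\<in>V. l u < r u \<and> (\<forall>v\<in>V. l u \<noteq> r v \<and> (u \<noteq> v \<longrightarrow> l u \<noteq> l v \<and> r u \<noteq> r v)))"
  unfolding chord_diagram_def inj_on_def by blast

lemma chord_diagramD:
  assumes "chord_diagram V l r" "u \<in> V" "v \<in> V"
  shows "l u < r u" "l u \<noteq> r v" "r u \<noteq> l v" "u \<noteq> v \<Longrightarrow> l u \<noteq> l v" "u \<noteq> v \<Longrightarrow> r u \<noteq> r v"
  using assms unfolding chord_diagram_iff by metis+

lemma crosses_sym: "crosses l r u v \<longleftrightarrow> crosses l r v u"
  by (auto simp: crosses_def)

text \<open>This parity form is convenient for rotations: moving the origin exchanges inside and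
  outside of \<open>u\<close> for both ends of \<open>v\<close> or for neither.\<close>

lemma crosses_iff_between:
  assumes "l u < r u" "l v < r v" "l u \<noteq> l v" "l u \<noteq> r v" "r u \<noteq> l v" "r u \<noteq> r v"
  shows "crosses l r u v \<longleftrightarrow> (l u < l v \<and> l v < r u) \<noteq> (l u < r v \<and> r v < r u)"
  using assms unfolding crosses_def by linarith

lemma represents_sym:
  "represents V E l r \<Longrightarrow> u \<in> V \<Longrightarrow> v \<in> V \<Longrightarrow> u \<noteq> v \<Longrightarrow> E u v \<longleftrightarrow> E v u"
  by (metis represents_def crosses_sym)

lemma represents_subset: "represents V E l r \<Longrightarrow> W \<subseteq> V \<Longrightarrow> represents W E l r"
  unfolding represents_def chord_diagram_iff by (meson subsetD)

text \<open>Serves all perturbations below. They move points by at most \<open>2 * e\<close>, so a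
  gap of \<open>10 * e\<close> keeps the order of points that were distinct.\<close>

lemma finite_gap:
  fixes F :: "real set"
  assumes "finite F"
  shows "\<exists>e>0. \<forall>x\<in>F. \<forall>y\<in>F. x \<noteq> y \<longrightarrow> x + 10 * e < y \<or> y + 10 * e < x"
proof -
  \<comment> \<open>\<open>insert 1\<close> makes \<open>D\<close> nonempty when \<open>F\<close>
    has at most one point; dividing by 11 below makes the gap \<open>10 * e\<close> strict.\<close>
  define D where "D = insert 1 ((\<lambda>(x, y). \<bar>x - y\<bar>) ` {(x, y) \<in> F \<times> F. x \<noteq> y})"
  have "{(x, y) \<in> F \<times> F. x \<noteq> y} \<subseteq> F \<times> F" by auto
  hence "finite {(x, y) \<in> F \<times> F. x \<noteq> y}"
    by (rule finite_subset) (simp add: assms)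
  hence fin: "finite D" unfolding D_def by (intro finite.insertI finite_imageI)
  define e where "e = Min D / 11"
  have "Min D \<in> D" using fin by (intro Min_in) (auto simp: D_def)
  hence pos: "0 < Min D" by (auto simp: D_def)
  have "x + 10 * e < y \<or> y + 10 * e < x" if "x \<in> F" "y \<in> F" "x \<noteq> y" for x y
  proof -
    have "(x, y) \<in> {(x, y) \<in> F \<times> F. x \<noteq> y}" using that by simp
    hence "\<bar>x - y\<bar> \<in> D" unfolding D_def by (metis (no_types, lifting) case_prod_conv imageI insertI2)
    hence "Min D \<le> \<bar>x - y\<bar>" using fin by simp
    thus ?thesis using pos by (auto simp: e_def abs_if split: if_splits)
  qed
  thus ?thesis using pos by (intro exI[of _ e]) (auto simp: e_def)
qed

section \<open>Inserting an isolated chord or a twin\<close>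

lemma representsI_insert:
  assumes rep: "represents V E l r" and v: "v \<notin> V"
    and "a < b"
    and ne: "\<And>u. u \<in> V \<Longrightarrow> a \<noteq> l u \<and> a \<noteq> r u \<and> b \<noteq> l u \<and> b \<noteq> r u"
    and E: "\<And>u. u \<in> V \<Longrightarrow> E u v \<longleftrightarrow> E v u"
    and cr: "\<And>u. u \<in> V \<Longrightarrow> E v u \<longleftrightarrow> crosses (l(v := a)) (r(v := b)) v u"
  shows "represents (insert v V) E (l(v := a)) (r(v := b))"
proof -
  have "chord_diagram (insert v V) (l(v := a)) (r(v := b))"
    unfolding chord_diagram_iff
  proof (intro ballI conjI impI)
    fix u w assume "u \<in> insert v V" "w \<in> insert v V"
    thus "(l(v := a)) u \<noteq> (r(v := b)) w"
      using rep v ne \<open>a < b\<close> unfolding represents_def chord_diagram_iff by (auto dest: sym)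
    assume "u \<noteq> w"
    with \<open>u \<in> _\<close> \<open>w \<in> _\<close> show "(l(v := a)) u \<noteq> (l(v := a)) w" "(r(v := b)) u \<noteq> (r(v := b)) w"
      using rep v ne unfolding represents_def chord_diagram_iff by (auto dest: sym)
  qed (use rep \<open>a < b\<close> in \<open>auto simp: represents_def chord_diagram_iff\<close>)
  moreover have "E u w \<longleftrightarrow> crosses (l(v := a)) (r(v := b)) u w"
    if uw: "u \<in> insert v V" "w \<in> insert v V" "u \<noteq> w" for u w
  proof -
    consider "u = v" "w \<in> V" | "w = v" "u \<in> V" | "u \<in> V" "w \<in> V" "u \<noteq> v" "w \<noteq> v"
      using uw v by blast
    thus ?thesis
    proof cases
      case 3
      thus ?thesis using rep uw by (auto simp: represents_def crosses_def)
    qed (use cr E crosses_sym in metis)+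
  qed
  ultimately show ?thesis by (auto simp: represents_def)
qed

text \<open>A chord of half-width \<open>e\<close> around a cut crosses nothing. Its long arc needs
  a cut too, which is why \<open>2 \<le> k\<close> is assumed.\<close>

lemma cuttable_isolated:
  assumes cut: "cuttable V E k" and fin: "finite V" and v: "v \<notin> V" and "2 \<le> k"
    and iso: "\<And>u. u \<in> V \<Longrightarrow> \<not> E u v \<and> \<not> E v u"
  shows "cuttable (insert v V) E k"
proof -
  obtain l r X where rep: "represents V E l r" and X: "finite X" "card X = k" "separates X V l r"
    using cut by (auto simp: cuttable_def)
  have "card X \<ge> 2" using X assms by simp
  then obtain x y where xy: "x \<in> X" "y \<in> X" "x \<noteq> y"
    by (metis X(1) One_nat_def Suc_1 card_le_Suc0_iff_eq not_less_eq_eq)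
  define F where "F = l ` V \<union> r ` V \<union> X"
  have "finite F" using fin X by (simp add: F_def)
  from finite_gap[OF this] obtain e where e: "e > 0"
    and gap: "\<And>x y. x \<in> F \<Longrightarrow> y \<in> F \<Longrightarrow> x \<noteq> y \<Longrightarrow> x + 10 * e < y \<or> y + 10 * e < x"
    by blast
  have near: "z + 10 * e < x \<or> x + 10 * e < z" if "z \<in> F" "z \<noteq> x" for z
    using gap[of z x] that xy by (auto simp: F_def)
  have ends: "l u \<in> F" "r u \<in> F" "l u \<noteq> x" "r u \<noteq> x" if "u \<in> V" for u
    using that X xy by (auto simp: F_def separates_def)
  have near': "l u + 10 * e < x \<or> x + 10 * e < l u" "r u + 10 * e < x \<or> x + 10 * e < r u"
    if "u \<in> V" for u
    using near ends that by auto
  let ?l = "l(v := x - e)" and ?r = "r(v := x + e)"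
  have "represents (insert v V) E ?l ?r"
  proof (rule representsI_insert[OF rep v])
    fix u assume u: "u \<in> V"
    show "x - e \<noteq> l u \<and> x - e \<noteq> r u \<and> x + e \<noteq> l u \<and> x + e \<noteq> r u"
      using near'[OF u] e by auto
    show "E v u \<longleftrightarrow> crosses ?l ?r v u"
      using near'[OF u] e iso[OF u] u v by (auto simp: crosses_def)
  qed (use e iso in auto)
  moreover have "separates X (insert v V) ?l ?r"
    unfolding separates_def
  proof (intro conjI ballI)
    have "x - e \<noteq> z" "x + e \<noteq> z" if "z \<in> X" for z
      using near[of z] e that by (cases "z = x"; force simp: F_def)+
    thus "X \<inter> (?l ` insert v V \<union> ?r ` insert v V) = {}"
      using X(3) v by (auto simp: separates_def)
    fix u assume u: "u \<in> insert v V"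
    show "\<exists>x\<in>X. ?l u < x \<and> x < ?r u"
    proof (cases "u = v")
      case True
      thus ?thesis using xy e by (auto intro!: bexI[of _ x])
    qed (use u X(3) in \<open>auto simp: separates_def\<close>)
    show "\<exists>x\<in>X. x < ?l u \<or> ?r u < x"
    proof (cases "u = v")
      case True
      thus ?thesis using near[of y] xy e by (auto simp: F_def intro!: bexI[of _ y])
    qed (use u X(3) in \<open>auto simp: separates_def\<close>)
  qed
  ultimately show ?thesis using X by (auto simp: cuttable_def)
qed

text \<open>The new chord runs alongside \<open>u\<close>, nearer to it than any other endpoint or
  cut. So it crosses the same further chords, and its arcs contain the same cuts.\<close>

lemma cuttable_twin:
  assumes cut: "cuttable V E k" and fin: "finite V" and v: "v \<notin> V" and u: "u \<in> V"
    and sym: "\<And>w. w \<in> V \<Longrightarrow> E w v \<longleftrightarrow> E v w"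
    and twin: "\<And>w. w \<in> V \<Longrightarrow> w \<noteq> u \<Longrightarrow> E v w \<longleftrightarrow> E u w"
  shows "cuttable (insert v V) E k"
proof -
  obtain l r X where rep: "represents V E l r" and X: "finite X" "card X = k" "separates X V l r"
    using cut by (auto simp: cuttable_def)
  define F where "F = l ` V \<union> r ` V \<union> X"
  have "finite F" using fin X by (simp add: F_def)
  from finite_gap[OF this] obtain e where e: "e > 0"
    and gap: "\<And>x y. x \<in> F \<Longrightarrow> y \<in> F \<Longrightarrow> x \<noteq> y \<Longrightarrow> x + 10 * e < y \<or> y + 10 * e < x"
    by blast
  have ends: "l w \<in> F" "r w \<in> F" if "w \<in> V" for w
    using that by (auto simp: F_def)
  have dia: "chord_diagram V l r" using rep by (simp add: represents_def)
  hence lu: "l u + 10 * e < r u"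
    using gap[of "l u" "r u"] ends u e by (fastforce simp: chord_diagram_iff)
  have near: "l w + 10 * e < l u \<or> l u + 10 * e < l w" "r w + 10 * e < l u \<or> l u + 10 * e < r w"
    "l w + 10 * e < r u \<or> r u + 10 * e < l w" "r w + 10 * e < r u \<or> r u + 10 * e < r w"
    if "w \<in> V" "w \<noteq> u" for w
    using that u by (intro gap ends chord_diagramD[OF dia]; simp)+
  have nearX: "x + 10 * e < l u \<or> l u + 10 * e < x" "x + 10 * e < r u \<or> r u + 10 * e < x"
    if "x \<in> X" for x
  proof -
    have "x \<noteq> l u" "x \<noteq> r u" using that X(3) u by (auto simp: separates_def)
    moreover have "x \<in> F" using that by (simp add: F_def)
    ultimately show "x + 10 * e < l u \<or> l u + 10 * e < x" "x + 10 * e < r u \<or> r u + 10 * e < x"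
      using gap ends[OF u] by blast+
  qed
  \<comment> \<open>Shifting both ends to the right makes the twins cross; shifting the right end to
    the left nests the new chord inside \<open>u\<close>.\<close>
  define s where "s = (if E v u then e else - e)"
  have s: "s = e \<and> E v u \<or> s = - e \<and> \<not> E v u" by (simp add: s_def)
  let ?l = "l(v := l u + e)" and ?r = "r(v := r u + s)"
  have uv: "u \<noteq> v" using u v by auto
  have "represents (insert v V) E ?l ?r"
  proof (rule representsI_insert[OF rep v])
    show "l u + e < r u + s" using lu e s by auto
    fix w assume w: "w \<in> V"
    show "E w v \<longleftrightarrow> E v w" by (rule sym[OF w])
    show "l u + e \<noteq> l w \<and> l u + e \<noteq> r w \<and> r u + s \<noteq> l w \<and> r u + s \<noteq> r w"
      using near[OF w] lu e s by (cases "w = u") auto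
    have wv: "w \<noteq> v" using w v by auto
    show "E v w \<longleftrightarrow> crosses ?l ?r v w"
    proof (cases "w = u")
      case True
      thus ?thesis using lu e s uv by (auto simp: crosses_def)
    next
      case False
      hence "E v w \<longleftrightarrow> crosses l r u w"
        using twin[OF w] rep u w by (auto simp: represents_def)
      also have "\<dots> \<longleftrightarrow> crosses ?l ?r v w"
      proof -
        have "\<bar>s\<bar> \<le> e" using s e by auto
        have "l u + e < z \<longleftrightarrow> l u < z" "z < l u + e \<longleftrightarrow> z < l u" "r u + s < z \<longleftrightarrow> r u < z" "z < r u + s \<longleftrightarrow> z < r u"
          if "z = l w \<or> z = r w" for z
        proof -
          have "z + 10 * e < l u \<or> l u + 10 * e < z" "z + 10 * e < r u \<or> r u + 10 * e < z"
            using near[OF w False] that by metis+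
          thus "l u + e < z \<longleftrightarrow> l u < z" "z < l u + e \<longleftrightarrow> z < l u"
            "r u + s < z \<longleftrightarrow> r u < z" "z < r u + s \<longleftrightarrow> z < r u"
            using e \<open>\<bar>s\<bar> \<le> e\<close> by linarith+
        qed
        thus ?thesis using wv by (simp add: crosses_def)
      qed
      finally show ?thesis .
    qed
  qed
  moreover have "separates X (insert v V) ?l ?r"
    unfolding separates_def
  proof (intro conjI ballI)
    have "l u + e \<noteq> z" "r u + s \<noteq> z" if "z \<in> X" for z
      using nearX[OF that] e s by auto
    thus "X \<inter> (?l ` insert v V \<union> ?r ` insert v V) = {}"
      using X(3) v by (auto simp: separates_def)
    fix w assume w: "w \<in> insert v V"
    obtain x y where xy: "x \<in> X" "l u < x" "x < r u" "y \<in> X" "y < l u \<or> r u < y"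
      using X(3) u unfolding separates_def by blast
    show "\<exists>x\<in>X. ?l w < x \<and> x < ?r w"
    proof (cases "w = v")
      case True
      thus ?thesis using xy nearX[of x] e s by (auto intro!: bexI[of _ x])
    qed (use w X(3) in \<open>auto simp: separates_def\<close>)
    show "\<exists>x\<in>X. x < ?l w \<or> ?r w < x"
    proof (cases "w = v")
      case True
      thus ?thesis using xy nearX[of y] e s by (auto intro!: bexI[of _ y])
    qed (use w X(3) in \<open>auto simp: separates_def\<close>)
  qed
  ultimately show ?thesis using X by (auto simp: cuttable_def)
qed

section \<open>Rotating the circle\<close>

text \<open>Rotates the circle so that its origin moves to \<open>t\<close>.\<close>
definition turn :: "real \<Rightarrow> real \<Rightarrow> real \<Rightarrow> real" where
  "turn t M x = (if x < t then x + M else x)"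

lemma finite_span:
  fixes F :: "real set"
  assumes "finite F"
  shows "\<exists>M>0. \<forall>x\<in>F. \<forall>y\<in>F. x < y + M"
proof -
  define b where "b = Max (abs ` F)"
  have b: "\<bar>x\<bar> \<le> b" if "x \<in> F" for x
    using that assms by (simp add: b_def)
  hence "x < y + (2 * \<bar>b\<bar> + 1)" if "x \<in> F" "y \<in> F" for x y
    using b[OF that(1)] b[OF that(2)] by linarith
  thus ?thesis by (intro exI[of _ "2 * \<bar>b\<bar> + 1"]) auto
qed

lemma turn_eq_iff:
  assumes "x < y + M" "y < x + M"
  shows "turn t M x = turn t M y \<longleftrightarrow> x = y"
  using assms by (auto simp: turn_def)

text \<open>The chord is turned inside out exactly when its left end is moved and its right end is
  not, that is, when \<open>a < t \<and> t \<le> b\<close>.\<close>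

lemma turn_between:
  fixes a b :: real
  assumes "a < b" "b < a + M" "0 < M"
    and "x < a + M" "x < b + M" "a < x + M" "b < x + M" "x \<noteq> a" "x \<noteq> b"
  shows "min (turn t M a) (turn t M b) < turn t M x \<and> turn t M x < max (turn t M a) (turn t M b)
    \<longleftrightarrow> (a < x \<and> x < b) \<noteq> (a < t \<and> t \<le> b)"
  unfolding turn_def using assms
  by (cases "x < t"; cases "a < t"; cases "b < t") auto

text \<open>By \<open>turn_between\<close> both ends of \<open>v\<close> change sides with respect
  to \<open>u\<close> or neither does, which cancels in \<open>crosses_iff_between\<close>.\<close>

lemma crosses_turn:
  assumes "\<And>x y. x \<in> {l u, r u, l v, r v} \<Longrightarrow> y \<in> {l u, r u, l v, r v} \<Longrightarrow> x < y + M" "0 < M"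
    and "l u < r u" "l v < r v" "l u \<noteq> l v" "l u \<noteq> r v" "r u \<noteq> l v" "r u \<noteq> r v"
  shows "crosses (\<lambda>v. min (turn t M (l v)) (turn t M (r v)))
                 (\<lambda>v. max (turn t M (l v)) (turn t M (r v))) u v \<longleftrightarrow> crosses l r u v"
proof -
  have *: "l u < l v + M" "l v < l u + M" "l u < r v + M" "l v < r u + M"
     "r u < l v + M" "r v < l u + M" "r u < r v + M" "r v < r u + M" "r u < l u + M" "r v < l v + M"
    by (rule assms(1); simp)+
  let ?l = "\<lambda>v. min (turn t M (l v)) (turn t M (r v))"
  let ?r = "\<lambda>v. max (turn t M (l v)) (turn t M (r v))"
  define in_u where "in_u = (\<lambda>x. ?l u < x \<and> x < ?r u)"
  have in_u: "in_u (turn t M x) \<longleftrightarrow> (l u < x \<and> x < r u) \<noteq> (l u < t \<and> t \<le> r u)"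
    if "x < l u + M" "x < r u + M" "l u < x + M" "r u < x + M" "x \<noteq> l u" "x \<noteq> r u" for x
    unfolding in_u_def using that * \<open>l u < r u\<close> \<open>0 < M\<close> by (intro turn_between)
  have turn_ne: "turn t M x \<noteq> turn t M y"
    if "x \<noteq> y" "x \<in> {l u, r u, l v, r v}" "y \<in> {l u, r u, l v, r v}" for x y
    using turn_eq_iff[of x y M t] assms(1) that by blast
  have "crosses ?l ?r u v \<longleftrightarrow> in_u (?l v) \<noteq> in_u (?r v)"
  proof -
    have "turn t M (l u) \<noteq> turn t M (r u)" "turn t M (l v) \<noteq> turn t M (r v)"
      using assms(3,4) by (intro turn_ne; simp)+
    hence "?l u < ?r u" "?l v < ?r v" by (simp_all add: min_def max_def)
    moreover have "turn t M (l u) \<noteq> turn t M (l v)" "turn t M (l u) \<noteq> turn t M (r v)"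
      "turn t M (r u) \<noteq> turn t M (l v)" "turn t M (r u) \<noteq> turn t M (r v)"
      using assms(5-) by (intro turn_ne; simp)+
    hence "?l u \<noteq> ?l v" "?l u \<noteq> ?r v" "?r u \<noteq> ?l v" "?r u \<noteq> ?r v"
      by (simp_all add: min_def max_def)
    ultimately show ?thesis
      unfolding in_u_def by (rule crosses_iff_between)
  qed
  also have "\<dots> \<longleftrightarrow> in_u (turn t M (l v)) \<noteq> in_u (turn t M (r v))"
    by (auto simp: min_def max_def)
  also have "\<dots> \<longleftrightarrow> crosses l r u v"
  proof -
    have "in_u (turn t M (l v)) \<longleftrightarrow> (l u < l v \<and> l v < r u) \<noteq> (l u < t \<and> t \<le> r u)"
      "in_u (turn t M (r v)) \<longleftrightarrow> (l u < r v \<and> r v < r u) \<noteq> (l u < t \<and> t \<le> r u)"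
      using * assms(3-) by (intro in_u; simp)+
    moreover have "crosses l r u v \<longleftrightarrow> (l u < l v \<and> l v < r u) \<noteq> (l u < r v \<and> r v < r u)"
      using assms(3-) by (rule crosses_iff_between)
    ultimately show ?thesis by argo
  qed
  finally show ?thesis .
qed

lemma rotate:
  assumes rep: "represents V E l r" and fin: "finite V" "finite X"
  obtains M l' r' where "represents V E l' r'"
    and "\<And>x. x \<in> X \<Longrightarrow> t \<le> turn t M x" "\<And>x y. x \<in> X \<Longrightarrow> y \<in> X \<Longrightarrow> turn t M x = turn t M y \<longleftrightarrow> x = y"
    and "\<And>v. v \<in> V \<Longrightarrow> t \<le> l' v \<and> {l' v, r' v} = {turn t M (l v), turn t M (r v)}"
    and "separates X V l r \<Longrightarrow> separates (turn t M ` X) V l' r'"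
proof -
  define F where "F = insert t (l ` V \<union> r ` V \<union> X)"
  have "finite F" using fin by (simp add: F_def)
  from finite_span[OF this] obtain M where M: "0 < M" "\<And>x y. x \<in> F \<Longrightarrow> y \<in> F \<Longrightarrow> x < y + M"
    by blast
  have ge: "t \<le> turn t M x" if "x \<in> F" for x
  proof -
    have "t \<in> F" by (simp add: F_def)
    hence "t < x + M" using that M(2) by blast
    thus ?thesis by (simp add: turn_def)
  qed
  have inj: "turn t M x = turn t M y \<longleftrightarrow> x = y" if "x \<in> F" "y \<in> F" for x y
    using M(2) that by (intro turn_eq_iff) auto
  \<comment> \<open>Turning only one end of a chord reverses their order, hence \<open>min\<close>
    and \<open>max\<close>.\<close>
  let ?l = "\<lambda>v. min (turn t M (l v)) (turn t M (r v))"
  let ?r = "\<lambda>v. max (turn t M (l v)) (turn t M (r v))"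
  have ends: "l v \<in> F" "r v \<in> F" if "v \<in> V" for v
    using that by (auto simp: F_def)
  have dia: "chord_diagram V l r" using rep by (simp add: represents_def)
  have "chord_diagram V ?l ?r"
    unfolding chord_diagram_iff
  proof (intro ballI conjI impI)
    fix u assume u: "u \<in> V"
    have "turn t M (l u) \<noteq> turn t M (r u)"
      using dia ends u by (subst inj) (auto simp: chord_diagram_iff)
    thus "?l u < ?r u" by (auto simp: min_def max_def)
    fix v assume v: "v \<in> V"
    have ne: "turn t M x \<noteq> turn t M y" if "u \<noteq> v" "x \<in> {l u, r u}" "y \<in> {l v, r v}" for x y
    proof -
      have "l u \<noteq> r v" "l v \<noteq> r u" "l u \<noteq> l v" "r u \<noteq> r v"
        using that dia u v unfolding chord_diagram_iff by blast+
      hence "x \<noteq> y" using that by auto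
      thus ?thesis using that ends u v by (subst inj) auto
    qed
    show "?l u \<noteq> ?r v"
      using ne \<open>?l u < ?r u\<close> by (cases "u = v") (auto simp: min_def max_def)
    assume "u \<noteq> v"
    thus "?l u \<noteq> ?l v" "?r u \<noteq> ?r v"
      using ne by (auto simp: min_def max_def)
  qed
  moreover have "crosses ?l ?r u v \<longleftrightarrow> crosses l r u v" if "u \<in> V" "v \<in> V" "u \<noteq> v" for u v
  proof (rule crosses_turn)
    show "x < y + M" if "x \<in> {l u, r u, l v, r v}" "y \<in> {l u, r u, l v, r v}" for x y
      using that ends[OF \<open>u \<in> V\<close>] ends[OF \<open>v \<in> V\<close>] by (intro M(2)) auto
  qed (use M chord_diagramD[OF dia] that in blast)+
  ultimately have "represents V E ?l ?r"
    using rep by (auto simp: represents_def)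
  moreover have "separates (turn t M ` X) V ?l ?r" if sep: "separates X V l r"
    unfolding separates_def
  proof (intro conjI ballI)
    have "turn t M x \<noteq> turn t M y" if "x \<in> X" "y \<in> l ` V \<union> r ` V" for x y
      using that sep by (subst inj) (auto simp: separates_def F_def)
    hence "turn t M x \<noteq> ?l v" "turn t M x \<noteq> ?r v" if "x \<in> X" "v \<in> V" for x v
      using that by (auto simp: min_def max_def)
    thus "turn t M ` X \<inter> (?l ` V \<union> ?r ` V) = {}"
      by blast
    fix v assume v: "v \<in> V"
    obtain x y where xy: "x \<in> X" "l v < x" "x < r v" "y \<in> X" "y < l v \<or> r v < y"
      using sep v unfolding separates_def by blast
    have *: "x < y + M" "y < x + M" "x < l v + M" "x < r v + M" "y < l v + M" "y < r v + M"
      "l v < x + M" "r v < x + M" "l v < y + M" "r v < y + M" "l v < r v + M" "r v < l v + M"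
    proof -
      have "x \<in> F" "y \<in> F" using xy by (simp_all add: F_def)
      thus "x < y + M" "y < x + M" "x < l v + M" "x < r v + M" "y < l v + M" "y < r v + M"
        "l v < x + M" "r v < x + M" "l v < y + M" "r v < y + M" "l v < r v + M" "r v < l v + M"
        using ends[OF v] M(2) by blast+
    qed
    have ne: "x \<noteq> l v" "x \<noteq> r v" "y \<noteq> l v" "y \<noteq> r v"
      using xy sep v by (auto simp: separates_def)
    \<comment> \<open>The cuts \<open>x\<close> and \<open>y\<close> witness the two arcs. If the
      origin crosses over the chord, they exchange roles: the inner one becomes the outer
      one.\<close>
    have "?l v < turn t M x \<and> turn t M x < ?r v \<longleftrightarrow> (l v < x \<and> x < r v) \<noteq> (l v < t \<and> t \<le> r v)"
      "?l v < turn t M y \<and> turn t M y < ?r v \<longleftrightarrow> (l v < y \<and> y < r v) \<noteq> (l v < t \<and> t \<le> r v)"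
      by (rule turn_between, (rule * ne M(1) chord_diagramD(1)[OF dia v v])+)+
    moreover have "l v < x \<and> x < r v" "\<not> (l v < y \<and> y < r v)"
      using xy(2,3,5) by linarith+
    moreover have "turn t M z \<noteq> ?l v" "turn t M z \<noteq> ?r v" if "z = x \<or> z = y" for z
    proof -
      have "turn t M z \<noteq> turn t M (l v)" "turn t M z \<noteq> turn t M (r v)"
        using that xy ends[OF v] ne by (subst inj; auto simp: F_def)+
      thus "turn t M z \<noteq> ?l v" "turn t M z \<noteq> ?r v" by (auto simp: min_def max_def)
    qed
    ultimately have "(?l v < turn t M x \<and> turn t M x < ?r v) \<and> (turn t M y < ?l v \<or> ?r v < turn t M y) \<or>
          (?l v < turn t M y \<and> turn t M y < ?r v) \<and> (turn t M x < ?l v \<or> ?r v < turn t M x)"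
      by (meson not_less_iff_gr_or_eq)
    thus "\<exists>x\<in>turn t M ` X. ?l v < x \<and> x < ?r v" "\<exists>x\<in>turn t M ` X. x < ?l v \<or> ?r v < x"
      using xy by blast+
  qed
  moreover have "t \<le> ?l v \<and> {?l v, ?r v} = {turn t M (l v), turn t M (r v)}" if "v \<in> V" for v
    using ge ends[OF that] by (auto simp: min_def max_def)
  moreover have "t \<le> turn t M x" "turn t M x = turn t M y \<longleftrightarrow> x = y" if "x \<in> X" "y \<in> X" for x y
    using ge inj that by (auto simp: F_def)
  ultimately show ?thesis using that by blast
qed

section \<open>Cuts at endpoints and the placement of pendants\<close>

text \<open>
  \<open>C\<close> are the supports. Points of \<open>X\<close> are endpoints of chords, and a cut at an endpoint counts for
  both arcs of its chord.
\<close>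
lemma stabbing_ends:
  assumes dia: "chord_diagram (C \<union> N) l r" and fin: "finite C" "finite N" and disj: "C \<inter> N = {}"
    and p: "p \<in> N" and least: "\<And>v. v \<in> C \<union> N \<Longrightarrow> l p \<le> l v"
    and inner: "\<And>v. v \<in> N \<Longrightarrow>
      \<exists>u\<in>C \<union> N. \<exists>w\<in>C \<union> N. u \<noteq> w \<and> u \<noteq> v \<and> w \<noteq> v \<and> crosses l r v u \<and> crosses l r v w"
  shows "\<exists>X \<subseteq> l ` (C \<union> N) \<union> r ` (C \<union> N). (\<forall>c\<in>C. l c \<in> X \<or> r c \<in> X) \<and>
    (\<forall>v\<in>N. (\<exists>x\<in>X. l v \<le> x \<and> x \<le> r v) \<and> (\<exists>x\<in>X. x \<le> l v \<or> r v \<le> x)) \<and>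
    2 * card X \<le> 2 * card C + card N + 1"
proof -
  note D = chord_diagramD[OF dia]
  \<comment> \<open>The point \<open>l p\<close> is cut by hand. Being leftmost, it serves the outer
    arc of every chord in \<open>N\<close>, and as an end of \<open>p\<close> it serves both arcs of
    \<open>p\<close>. Only the inner arcs of \<open>N - {p}\<close> remain to be stabbed.\<close>
  define A where "A = l ` N \<union> r ` N - {l p}"
  define B where "B = l ` C \<union> r ` C"
  define J where "J = (\<lambda>v. (l v, r v)) ` (N - {p})"
  have lr: "x \<noteq> y" if "x \<in> {l u, r u}" "y \<in> {l v, r v}" "u \<noteq> v" "u \<in> C \<union> N" "v \<in> C \<union> N" for x y u v
    using that D[of u v] by blast
  interpret weighted_intervals A B J
  proof
    show "finite A" "finite B" using fin by (auto simp: A_def B_def)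
    have "x \<notin> B" if xA: "x \<in> A" for x
    proof
      assume "x \<in> B"
      then obtain u v where uv: "u \<in> N" "x \<in> {l u, r u}" "v \<in> C" "x \<in> {l v, r v}"
        using xA unfolding A_def B_def by blast
      hence "u \<noteq> v" using disj by auto
      thus False using lr[OF uv(2,4)] uv by simp
    qed
    thus "A \<inter> B = {}" by auto
    show "a < b" if "(a, b) \<in> J" for a b
      using that D(1) unfolding J_def by blast
    show "J \<subseteq> A \<times> A"
      using p D(2,4)[of p] D(3)[of _ p] by (fastforce simp: J_def A_def)
    show "a = a'" if J: "(a, b) \<in> J" "(a', b) \<in> J" for a a' b
    proof -
      obtain u v where "u \<in> N" "v \<in> N" "a = l u" "a' = l v" "b = r u" "b = r v"
        using J unfolding J_def by blast
      thus ?thesis using D(5)[of u v] by auto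
    qed
    show "(b, c) \<notin> J" if "(a, b) \<in> J" for a b c
      using that D(3) by (auto simp: J_def)
    show "2 \<le> card ((A \<union> B) \<inter> {a<..<b})" if J: "(a, b) \<in> J" for a b
    proof -
      obtain v where v: "v \<in> N" "v \<noteq> p" "a = l v" "b = r v"
        using J unfolding J_def by blast
      obtain u w where uw: "u \<in> C \<union> N" "w \<in> C \<union> N" "u \<noteq> w" "crosses l r v u" "crosses l r v w"
        using inner[OF v(1)] by blast
      have *: "\<exists>x\<in>{l z, r z}. x \<in> (A \<union> B) \<inter> {a<..<b}" if z: "z \<in> C \<union> N" "crosses l r v z" for z
      proof -
        obtain x where x: "x \<in> {l z, r z}" "a < x" "x < b"
          using z(2) v(3,4) unfolding crosses_def by blast
        have "x \<noteq> l p" using least[of v] v x by auto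
        hence "x \<in> A \<union> B" using x z(1) by (auto simp: A_def B_def)
        thus ?thesis using x by auto
      qed
      obtain x y where xy: "x \<in> {l u, r u}" "x \<in> (A \<union> B) \<inter> {a<..<b}" "y \<in> {l w, r w}" "y \<in> (A \<union> B) \<inter> {a<..<b}"
        using *[OF uw(1,4)] *[OF uw(2,5)] by blast
      have "x \<noteq> y" using lr[OF xy(1,3) uw(3,1,2)] .
      moreover have "card {x, y} \<le> card ((A \<union> B) \<inter> {a<..<b})"
        using xy \<open>finite A\<close> \<open>finite B\<close> by (intro card_mono) auto
      ultimately show ?thesis by simp
    qed
  qed
  have "card (l ` N \<union> r ` N) = card (l ` N) + card (r ` N)"
    using fin dia by (intro card_Un_disjoint) (auto simp: chord_diagram_def)
  also have "\<dots> = 2 * card N"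
    using dia by (subst (1 2) card_image) (auto simp: chord_diagram_def intro: inj_on_subset)
  finally have "card A = 2 * card N - 1"
    using p fin by (simp add: A_def)
  moreover have "card N > 0" using p fin by (auto simp: card_gt_0_iff)
  ultimately have cA: "card A div 2 + 1 = card N" by linarith
  obtain Z where Z0: "Z \<subseteq> A \<union> B" "\<forall>(a, b)\<in>J. Z \<inter> {a..b} \<noteq> {}"
    "2 * card (Z \<inter> A) + card (Z \<inter> B) \<le> card A div 2"
    using stabbing_set by blast
  have Z: "Z \<subseteq> A \<union> B" "\<And>a b. (a, b) \<in> J \<Longrightarrow> Z \<inter> {a..b} \<noteq> {}"
    "2 * card (Z \<inter> A) + card (Z \<inter> B) + 1 \<le> card N"
    using Z0 cA by auto
  \<comment> \<open>The supports that \<open>Z\<close> does not cut get a cut of their own, at the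
    left end.\<close>
  define C0 where "C0 = {c \<in> C. l c \<notin> Z \<and> r c \<notin> Z}"
  define X where "X = insert (l p) (Z \<union> l ` C0)"
  \<comment> \<open>\<open>Z\<close> cuts \<open>card C - card C0\<close> supports, each at most
    twice. One cut per support is in the budget anyway, so points of \<open>B\<close> in
    \<open>Z\<close> cost on balance at most half a cut each.\<close>
  have "card (Z \<inter> B) \<le> card (l ` (C - C0) \<union> r ` (C - C0))"
    using fin by (intro card_mono) (auto simp: B_def C0_def)
  also have "\<dots> \<le> card (l ` (C - C0)) + card (r ` (C - C0))"
    by (rule card_Un_le)
  also have "\<dots> \<le> 2 * card (C - C0)"
    using card_image_le[of "C - C0" l] card_image_le[of "C - C0" r] fin by simp
  also have "\<dots> = 2 * (card C - card C0)"
    using fin by (subst card_Diff_subset) (auto simp: C0_def)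
  finally have W: "card (Z \<inter> B) + 2 * card C0 \<le> 2 * card C"
    using card_mono[of C C0] fin by (simp add: C0_def)
  have "card Z \<le> card (Z \<inter> A) + card (Z \<inter> B)"
    using Z(1) card_Un_le[of "Z \<inter> A" "Z \<inter> B"] by (metis Int_Un_distrib inf.orderE)
  moreover have "card X \<le> Suc (card (Z \<union> l ` C0))"
    unfolding X_def by (rule card_insert_le_m1[of "Suc (card (Z \<union> l ` C0))"]) auto
  moreover have "card (Z \<union> l ` C0) \<le> card Z + card C0"
    using card_Un_le[of Z "l ` C0"] card_image_le[of C0 l] fin by (simp add: C0_def)
  ultimately have card: "2 * card X \<le> 2 * card C + card N + 1"
    using W Z(3) by linarith
  have sub: "X \<subseteq> l ` (C \<union> N) \<union> r ` (C \<union> N)"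
    using Z(1) p by (auto simp: X_def A_def B_def C0_def)
  have c: "\<forall>c\<in>C. l c \<in> X \<or> r c \<in> X"
    by (auto simp: X_def C0_def)
  have "(\<exists>x\<in>X. l v \<le> x \<and> x \<le> r v) \<and> (\<exists>x\<in>X. x \<le> l v \<or> r v \<le> x)" if "v \<in> N" for v
  proof (cases "v = p")
    case True
    thus ?thesis using D(1)[of p p] p by (auto simp: X_def)
  next
    case False
    hence "Z \<inter> {l v..r v} \<noteq> {}"
      using that by (intro Z(2)) (auto simp: J_def)
    moreover have "l p \<le> l v" using that by (intro least) auto
    ultimately show ?thesis by (auto simp: X_def)
  qed
  thus ?thesis using sub c card by blast
qed

text \<open>A pendant becomes a chord of half-width \<open>2 * e\<close> around an end of its
  support that is in \<open>X\<close>. It crosses the support alone, and the cut at that end, pushed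
  off by only \<open>e\<close>, stays under it.\<close>

lemma cuttable_pendants:
  assumes rep: "represents H E l r" and fin: "finite H" "finite D" and disj: "D \<inter> H = {}"
    and s: "s ` D \<subseteq> H" "inj_on s D"
    and adj: "\<And>d w. d \<in> D \<Longrightarrow> w \<in> D \<union> H \<Longrightarrow> w \<noteq> d \<Longrightarrow> (E d w \<longleftrightarrow> w = s d) \<and> (E w d \<longleftrightarrow> w = s d)"
    and X: "X \<subseteq> l ` H \<union> r ` H" "\<And>d. d \<in> D \<Longrightarrow> l (s d) \<in> X \<or> r (s d) \<in> X"
      "\<And>v. v \<in> H \<Longrightarrow> \<exists>x\<in>X. l v \<le> x \<and> x \<le> r v" "\<And>v. v \<in> H \<Longrightarrow> \<exists>x\<in>X. x \<le> l v \<or> r v \<le> x"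
    and k: "card X \<le> k" "2 \<le> k"
  shows "cuttable (D \<union> H) E k"
proof -
  have dia: "chord_diagram H l r" using rep by (simp add: represents_def)
  note ne = chord_diagramD[OF dia]
  define P where "P = l ` H \<union> r ` H"
  have finP: "finite P" using fin by (simp add: P_def)
  have finX: "finite X" using X(1) finP by (auto simp: P_def intro: finite_subset)
  have "infinite (- P)" using finP infinite_UNIV_char_0 finite_compl by blast
  \<comment> \<open>Further cuts away from all endpoints bring the number up to exactly
    \<open>k\<close>.\<close>
  from infinite_arbitrarily_large[OF this] obtain Y where
    Y: "finite Y" "card Y = k - card X" "Y \<subseteq> - P" by blast
  define X1 where "X1 = X \<union> Y"
  have "X \<inter> Y = {}" using X(1) Y(3) unfolding P_def by blast
  hence X1: "finite X1" "card X1 = k" "X \<subseteq> X1"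
    using Y finX k by (simp_all add: X1_def card_Un_disjoint)
  obtain e where e: "0 < e" and gap0: "\<forall>x\<in>P \<union> X1. \<forall>y\<in>P \<union> X1. x \<noteq> y \<longrightarrow> x + 10 * e < y \<or> y + 10 * e < x"
    using finite_gap[of "P \<union> X1"] finP X1(1) by blast
  have gap: "x + 10 * e < y \<or> y + 10 * e < x" if "x \<in> P \<union> X1" "y \<in> P \<union> X1" "x \<noteq> y" for x y
    using gap0 that by blast
  have ends: "l v \<in> P" "r v \<in> P" if "v \<in> H" for v using that by (auto simp: P_def)
  \<comment> \<open>A cut at an end \<open>l v\<close> or \<open>r v\<close> has to be moved off it, and \<open>a\<close>, \<open>b\<close> are the directions: any other cut
    lies on one side of the chord, so the moved cut can serve the other side.\<close>
  define ins where "ins = (\<lambda>v a b. \<exists>x\<in>X1. l v < x \<and> x < r v \<or> x = l v \<and> a = (1::real) \<or> x = r v \<and> b = (-1::real))"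
  define out where "out = (\<lambda>v a b. \<exists>x\<in>X1. x < l v \<or> r v < x \<or> x = l v \<and> a = (-1::real) \<or> x = r v \<and> b = (1::real))"
  \<comment> \<open>If both ends of \<open>v\<close> are cut, one cut goes inwards and the other
    outwards. If only one is, it goes to the arc that does not contain some other cut.\<close>
  have "\<exists>a b. a \<in> {-1, 1} \<and> b \<in> {-1, 1} \<and> ins v a b \<and> out v a b" if v: "v \<in> H" for v
  proof -
    have other: "\<exists>x\<in>X1. x \<noteq> y" for y
      using X1 k by (metis One_nat_def Suc_1 card.empty card_le_Suc0_iff_eq finite.emptyI not_less_eq_eq)
    obtain x y where xy: "x \<in> X1" "l v \<le> x" "x \<le> r v" "y \<in> X1" "y \<le> l v \<or> r v \<le> y"
      using X(3,4)[OF v] X1(3) by blast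
    consider "l v \<in> X1" "r v \<in> X1" | "l v \<in> X1" "r v \<notin> X1" | "l v \<notin> X1" "r v \<in> X1"
      | "l v \<notin> X1" "r v \<notin> X1" by blast
    thus ?thesis
    proof cases
      case 1
      thus ?thesis by (intro exI[of _ 1]) (auto simp: ins_def out_def)
    next
      case 2
      obtain z where z: "z \<in> X1" "z \<noteq> l v" using other by blast
      hence "z \<noteq> r v" using 2 by auto
      show ?thesis
      proof (cases "l v < z \<and> z < r v")
        case True
        hence "ins v (-1) 1" "out v (-1) 1" using z 2 by (auto simp: ins_def out_def)
        thus ?thesis by blast
      next
        case False
        hence "z < l v \<or> r v < z" using z \<open>z \<noteq> r v\<close> by auto
        hence "ins v 1 1" "out v 1 1" using z 2 by (auto simp: ins_def out_def)
        thus ?thesis by blast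
      qed
    next
      case 3
      obtain z where z: "z \<in> X1" "z \<noteq> r v" using other by blast
      hence "z \<noteq> l v" using 3 by auto
      show ?thesis
      proof (cases "l v < z \<and> z < r v")
        case True
        hence "ins v 1 1" "out v 1 1" using z 3 by (auto simp: ins_def out_def)
        thus ?thesis by blast
      next
        case False
        hence "z < l v \<or> r v < z" using z \<open>z \<noteq> l v\<close> by auto
        hence "ins v 1 (-1)" "out v 1 (-1)" using z 3 by (auto simp: ins_def out_def)
        thus ?thesis by blast
      qed
    next
      case 4
      have "x \<noteq> l v" "x \<noteq> r v" "y \<noteq> l v" "y \<noteq> r v" using xy 4 by auto
      hence "l v < x \<and> x < r v" "y < l v \<or> r v < y" using xy by auto
      hence "ins v 1 1" "out v 1 1" using xy(1,4) by (auto simp: ins_def out_def)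
      thus ?thesis by blast
    qed
  qed
  then obtain a b where ab: "\<And>v. v \<in> H \<Longrightarrow> a v \<in> {-1, 1} \<and> b v \<in> {-1, 1} \<and> ins v (a v) (b v) \<and> out v (a v) (b v)"
    by metis
  \<comment> \<open>The default 0 leaves cuts that are not endpoints where they are.\<close>
  define \<delta> where "\<delta> x = (if x \<in> l ` H then a (inv_into H l x)
    else if x \<in> r ` H then b (inv_into H r x) else 0)" for x
  have \<delta>: "\<delta> (l v) = a v" "\<delta> (r v) = b v" if "v \<in> H" for v
    using that dia by (auto simp: \<delta>_def chord_diagram_def inv_into_f_f)
  have \<delta>_P: "\<delta> x = 1 \<or> \<delta> x = -1" if "x \<in> P" for x
  proof -
    obtain v where "v \<in> H" "x = l v \<or> x = r v" using \<open>x \<in> P\<close> unfolding P_def by blast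
    thus ?thesis using ab[of v] \<delta>[of v] by auto
  qed
  have \<delta>_le: "e * \<delta> x \<le> e" "- e \<le> e * \<delta> x" for x
  proof -
    have "\<delta> x = 1 \<or> \<delta> x = -1 \<or> \<delta> x = 0"
      using \<delta>_P[of x] by (auto simp: \<delta>_def P_def)
    thus "e * \<delta> x \<le> e" "- e \<le> e * \<delta> x" using e by auto
  qed
  define \<phi> where "\<phi> x = x + e * \<delta> x" for x
  have \<phi>: "x - e \<le> \<phi> x" "\<phi> x \<le> x + e" for x
    using \<delta>_le[of x] by (auto simp: \<phi>_def)
  have \<phi>_ne: "\<phi> x \<noteq> x" if "x \<in> P" for x
    using \<delta>_P[OF that] e by (auto simp: \<phi>_def)
  have inj: "inj_on \<phi> X1"
  proof (rule inj_onI, rule ccontr)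
    fix x y assume "x \<in> X1" "y \<in> X1" "\<phi> x = \<phi> y" "x \<noteq> y"
    thus False using gap[of x y] \<phi>[of x] \<phi>[of y] e by auto
  qed
  define q where "q d = (if l (s d) \<in> X then l (s d) else r (s d))" for d
  have q: "q d \<in> X1" "q d \<in> P" "q d = l (s d) \<or> q d = r (s d)" if "d \<in> D" for d
    using X(2)[OF that] X1(3) that s(1) ends[of "s d"] by (auto simp: q_def)
  define l' where "l' v = (if v \<in> D then q v - 2 * e else l v)" for v
  define r' where "r' v = (if v \<in> D then q v + 2 * e else r v)" for v
  have lr'_D: "l' d = q d - 2 * e" "r' d = q d + 2 * e" if "d \<in> D" for d
    using that by (simp_all add: l'_def r'_def)
  have lr'_H: "l' v = l v" "r' v = r v" if "v \<in> H" for v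
    using that disj by (auto simp: l'_def r'_def)
  have qq: "q c + 10 * e < q d \<or> q d + 10 * e < q c" if "c \<in> D" "d \<in> D" "c \<noteq> d" for c d
  proof -
    have "s c \<noteq> s d" "s c \<in> H" "s d \<in> H" using that s by (auto dest: inj_onD)
    hence "q c \<noteq> q d" using q(3)[OF that(1)] q(3)[OF that(2)] ne[of "s c" "s d"] by auto
    thus ?thesis using q that by (intro gap) auto
  qed
  have qP: "q d + 10 * e < x \<or> x + 10 * e < q d" if "d \<in> D" "x \<in> P \<union> X1" "x \<noteq> q d" for d x
    using gap[of "q d" x] q[OF that(1)] that by auto
  have farH: "x \<noteq> q d - 2 * e \<and> x \<noteq> q d + 2 * e" if "d \<in> D" "x \<in> P" for d x
    using qP[OF that(1), of x] that(2) e by (cases "x = q d") auto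
  have "chord_diagram (D \<union> H) l' r'"
    unfolding chord_diagram_iff
  proof (intro ballI conjI impI)
    fix u assume u: "u \<in> D \<union> H"
    show "l' u < r' u" using u e ne(1) lr'_D lr'_H by auto
    fix v assume v: "v \<in> D \<union> H"
    consider "u \<in> D" "v \<in> D" | "u \<in> D" "v \<in> H" | "u \<in> H" "v \<in> D" | "u \<in> H" "v \<in> H"
      using u v by blast
    hence "l' u \<noteq> r' v \<and> (u \<noteq> v \<longrightarrow> l' u \<noteq> l' v \<and> r' u \<noteq> r' v)"
    proof cases
      case 1
      thus ?thesis using qq[of u v] e by (cases "u = v") (auto simp: lr'_D)
    next
      case 2
      thus ?thesis using farH[of u "l v"] farH[of u "r v"] ends[of v] by (auto simp: lr'_D lr'_H)
    next
      case 3
      thus ?thesis using farH[of v "l u"] farH[of v "r u"] ends[of u] by (auto simp: lr'_D lr'_H)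
    next
      case 4
      thus ?thesis using ne[of u v] by (simp add: lr'_H)
    qed
    thus "l' u \<noteq> r' v" "u \<noteq> v \<Longrightarrow> l' u \<noteq> l' v" "u \<noteq> v \<Longrightarrow> r' u \<noteq> r' v" by auto
  qed
  moreover have DH: "w = s d \<longleftrightarrow> crosses l' r' d w" if d: "d \<in> D" and w: "w \<in> H" for d w
  proof (cases "w = s d")
    case True
    have "l w < r w" using ne(1) w by blast
    moreover have "q d = l w \<and> q d + 10 * e < r w \<or> q d = r w \<and> l w + 10 * e < q d"
      using True q(3)[OF d] qP[OF d, of "l w"] qP[OF d, of "r w"] ends[OF w] \<open>l w < r w\<close> e by auto
    ultimately have "crosses l' r' d w"
      unfolding crosses_def lr'_D[OF d] lr'_H[OF w] using e by auto
    thus ?thesis using True by simp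
  next
    case False
    have sd: "s d \<in> H" using s d by auto
    have "q d \<noteq> l w" "q d \<noteq> r w"
      using ne[OF sd w] False q(3)[OF d] by auto
    hence "q d + 10 * e < l w \<or> l w + 10 * e < q d" "q d + 10 * e < r w \<or> r w + 10 * e < q d"
      using qP[OF d] ends[OF w] by auto
    thus ?thesis using False e by (auto simp: crosses_def lr'_D[OF d] lr'_H[OF w])
  qed
  have DD: "\<not> crosses l' r' c d" if "c \<in> D" "d \<in> D" "c \<noteq> d" for c d
    using qq[OF that] e that by (auto simp: crosses_def lr'_D)
  have "E u v \<longleftrightarrow> crosses l' r' u v" if uv: "u \<in> D \<union> H" "v \<in> D \<union> H" "u \<noteq> v" for u v
  proof -
    have sD: "s d \<notin> D" if "d \<in> D" for d using that s disj by auto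
    consider "u \<in> D" "v \<in> D" | "u \<in> D" "v \<in> H" | "u \<in> H" "v \<in> D" | "u \<in> H" "v \<in> H"
      using uv by blast
    thus ?thesis
    proof cases
      case 1
      thus ?thesis using adj[of u v] DD[of u v] uv sD by auto
    next
      case 2
      thus ?thesis using adj[of u v] DH[of u v] uv by auto
    next
      case 3
      thus ?thesis using adj[of v u] DH[of v u] uv crosses_sym[of l' r' u v] by auto
    next
      case 4
      hence "crosses l' r' u v \<longleftrightarrow> crosses l r u v" by (simp add: crosses_def lr'_H)
      thus ?thesis using 4 rep uv by (auto simp: represents_def)
    qed
  qed
  ultimately have "represents (D \<union> H) E l' r'" by (auto simp: represents_def)
  moreover have "separates (\<phi> ` X1) (D \<union> H) l' r'"
    unfolding separates_def
  proof (intro conjI ballI)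
    have "\<phi> x \<noteq> l' v" "\<phi> x \<noteq> r' v" if "x \<in> X1" "v \<in> D \<union> H" for x v
    proof -
      have "\<phi> x \<noteq> z" if "z \<in> P" for z
        using gap[of x z] \<open>x \<in> X1\<close> that \<phi>[of x] \<phi>_ne[of x] e by (cases "x = z") auto
      moreover have "\<phi> x \<noteq> q d - 2 * e" "\<phi> x \<noteq> q d + 2 * e" if "d \<in> D" for d
        using qP[OF that, of x] \<open>x \<in> X1\<close> \<phi>[of x] e by (cases "x = q d"; auto)+
      ultimately show "\<phi> x \<noteq> l' v" "\<phi> x \<noteq> r' v"
        using that(2) ends lr'_D lr'_H by (metis UnE)+
    qed
    thus "\<phi> ` X1 \<inter> (l' ` (D \<union> H) \<union> r' ` (D \<union> H)) = {}" by blast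
    fix v assume "v \<in> D \<union> H"
    then consider "v \<in> D" | "v \<in> H" by blast
    hence "(\<exists>x\<in>X1. l' v < \<phi> x \<and> \<phi> x < r' v) \<and> (\<exists>x\<in>X1. \<phi> x < l' v \<or> r' v < \<phi> x)"
    proof cases
      case 1
      have "l' v < \<phi> (q v) \<and> \<phi> (q v) < r' v"
        using \<phi>[of "q v"] e by (simp add: lr'_D[OF 1])
      moreover have "\<exists>x\<in>X1. x \<noteq> q v"
        using X1 k by (metis One_nat_def Suc_1 card.empty card_le_Suc0_iff_eq finite.emptyI not_less_eq_eq)
      then obtain x where "x \<in> X1" "x \<noteq> q v" by blast
      moreover from this have "\<phi> x < l' v \<or> r' v < \<phi> x"
        using qP[OF 1, of x] \<phi>[of x] e by (auto simp: lr'_D[OF 1])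
      ultimately show ?thesis using q[OF 1] by blast
    next
      case 2
      obtain x where x: "x \<in> X1" "l v < x \<and> x < r v \<or> x = l v \<and> a v = 1 \<or> x = r v \<and> b v = -1"
        using ab[OF 2] by (auto simp: ins_def)
      have *: "x = l v \<or> l v + 10 * e < x \<or> x + 10 * e < l v" "x = r v \<or> r v + 10 * e < x \<or> x + 10 * e < r v"
        if "x \<in> X1" for x
        using gap[of x] that ends[OF 2] by blast+
      have lr: "l v + 10 * e < r v"
        using gap[of "l v" "r v"] ends[OF 2] ne(1)[OF 2 2] e by auto
      have \<phi>_lr: "\<phi> (l v) = l v + e * a v" "\<phi> (r v) = r v + e * b v"
        using \<delta>[OF 2] by (simp_all add: \<phi>_def)
      have "l v < \<phi> x \<and> \<phi> x < r v"
        using x(2) *[OF x(1)] \<phi>[of x] \<phi>_lr e lr by auto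
      moreover obtain y where y: "y \<in> X1" "y < l v \<or> r v < y \<or> y = l v \<and> a v = -1 \<or> y = r v \<and> b v = 1"
        using ab[OF 2] by (auto simp: out_def)
      have "\<phi> y < l v \<or> r v < \<phi> y"
        using y(2) *[OF y(1)] \<phi>[of y] \<phi>_lr e lr by auto
      ultimately show ?thesis using x(1) y(1) lr'_H[OF 2] by auto
    qed
    thus "\<exists>x\<in>\<phi> ` X1. l' v < x \<and> x < r' v" "\<exists>x\<in>\<phi> ` X1. x < l' v \<or> r' v < x" by blast+
  qed
  moreover have "card (\<phi> ` X1) = k" "finite (\<phi> ` X1)"
    using inj X1 by (simp_all add: card_image)
  ultimately show ?thesis by (auto simp: cuttable_def)
qed

section \<open>The bound for chord diagrams\<close>

theorem cuttable_if_card_le: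
  assumes "represents V E l r" "finite V" "card V \<le> 2 * k" "2 \<le> k"
  shows "cuttable V E k"
  using assms
proof (induction "card V" arbitrary: V l r rule: less_induct)
  case less
  note rep = less.prems(1) and fin = less.prems(2)
  note sym = represents_sym[OF rep]
  \<comment> \<open>\<open>k\<close> is kept when a vertex is deleted, and putting the vertex back
    below needs no new cut.\<close>
  have IH: "cuttable (V - {v}) E k" if "v \<in> V" for v
  proof (rule less.hyps)
    show "card (V - {v}) < card V" using that fin by (intro card_Diff1_less)
    thus "card (V - {v}) \<le> 2 * k" using less.prems(3) by simp
    show "represents (V - {v}) E l r" by (rule represents_subset[OF rep]) auto
  qed (use fin less.prems in auto)
  show ?case
  proof (cases "\<exists>v\<in>V. \<forall>u\<in>V - {v}. \<not> E u v")
    case True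
    then obtain v where v: "v \<in> V" "\<And>u. u \<in> V - {v} \<Longrightarrow> \<not> E u v" by blast
    have "cuttable (insert v (V - {v})) E k"
      using v sym fin less.prems(4) by (intro cuttable_isolated IH) auto
    thus ?thesis using v(1) by (simp add: insert_absorb)
  next
    case no_iso: False
    show ?thesis
    proof (cases "\<exists>v\<in>V. \<exists>u\<in>V - {v}. \<forall>w\<in>V - {u, v}. E v w \<longleftrightarrow> E u w")
      case True
      then obtain u v where uv: "v \<in> V" "u \<in> V - {v}" "\<And>w. w \<in> V - {u, v} \<Longrightarrow> E v w \<longleftrightarrow> E u w"
        by blast
      have "cuttable (insert v (V - {v})) E k"
        using uv sym fin by (intro cuttable_twin[where u = u] IH) auto
      thus ?thesis using uv(1) by (simp add: insert_absorb)
    next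
      case no_twins: False
      have no_twin: False if "v \<in> V" "u \<in> V" "u \<noteq> v" "\<And>w. w \<in> V - {u, v} \<Longrightarrow> E v w \<longleftrightarrow> E u w" for u v
      proof -
        have "u \<in> V - {v}" using that by simp
        moreover have "\<forall>w\<in>V - {u, v}. E v w \<longleftrightarrow> E u w" by (intro ballI that(4))
        ultimately have "\<exists>u\<in>V - {v}. \<forall>w\<in>V - {u, v}. E v w \<longleftrightarrow> E u w" by (rule bexI[rotated])
        hence "\<exists>v\<in>V. \<exists>u\<in>V - {v}. \<forall>w\<in>V - {u, v}. E v w \<longleftrightarrow> E u w"
          using that(1) by (rule bexI)
        thus False using no_twins by (rule notE[rotated])
      qed
      define nb where "nb v = {w \<in> V. w \<noteq> v \<and> E v w}" for v
      define D where "D = {d \<in> V. \<exists>c. nb d = {c}}"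
      define s where "s d = the_elem (nb d)" for d
      have nb_D: "nb d = {s d}" if "d \<in> D" for d
      proof -
        obtain c where "nb d = {c}" using \<open>d \<in> D\<close> unfolding D_def by blast
        thus ?thesis by (simp add: s_def)
      qed
      have E_D: "E d w \<longleftrightarrow> w = s d" if "d \<in> D" "w \<in> V" "w \<noteq> d" for d w
      proof -
        have "w \<in> nb d \<longleftrightarrow> w = s d" using nb_D[OF that(1)] by simp
        thus ?thesis using that by (simp add: nb_def)
      qed
      have s_V: "s d \<in> V" "s d \<noteq> d" if "d \<in> D" for d
      proof -
        have "s d \<in> nb d" using nb_D[OF that] by simp
        thus "s d \<in> V" "s d \<noteq> d" by (simp_all add: nb_def)
      qed
      have D_V: "D \<subseteq> V" by (auto simp: D_def)
      \<comment> \<open>Two pendants at the same support would be twins.\<close>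
      have inj: "inj_on s D"
      proof (rule inj_onI, rule ccontr)
        fix c d assume "c \<in> D" "d \<in> D" "s c = s d" "c \<noteq> d"
        thus False using E_D D_V by (intro no_twin[of c d]) auto
      qed
      \<comment> \<open>Two pendants joined to each other form a component of their own and are
        twins as well.\<close>
      have s_D: "s d \<notin> D" if d: "d \<in> D" for d
      proof
        assume sd: "s d \<in> D"
        have "E (s d) d" using E_D[OF d] s_V[OF d] sym[of d "s d"] d D_V by auto
        hence "s (s d) = d" using E_D[OF sd, of d] s_V[OF d] d D_V by auto
        thus False using E_D[OF d] E_D[OF sd] s_V[OF d] d D_V by (intro no_twin[of d "s d"]) auto
      qed
      define C where "C = s ` D"
      define N where "N = V - D - C"
      have H: "D \<union> (C \<union> N) = V" "D \<inter> (C \<union> N) = {}" "C \<inter> N = {}" "C \<union> N \<subseteq> V"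
        using s_V s_D D_V by (auto simp: C_def N_def)
      have fins: "finite C" "finite N" "finite D" "finite (C \<union> N)"
        using fin H(1) by (metis finite_Un)+
      have "card V = card D + (card C + card N)"
        using fins H by (metis card_Un_disjoint)
      moreover have "card C = card D" using inj by (simp add: C_def card_image)
      ultimately have card: "2 * card C + card N \<le> 2 * k" using less.prems(3) by simp
      \<comment> \<open>A neighbour in \<open>D\<close> would make \<open>v\<close> a support, so
        all neighbours are in \<open>C \<union> N\<close>. There are two, since \<open>v\<close> is
        neither isolated nor pendant.\<close>
      have two: "\<exists>u\<in>C \<union> N. \<exists>w\<in>C \<union> N. u \<noteq> w \<and> u \<noteq> v \<and> w \<noteq> v \<and> E v u \<and> E v w" if v: "v \<in> N" for v
      proof -
        have vV: "v \<in> V" "v \<notin> D" "v \<notin> C" using v by (auto simp: N_def)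
        have nbH: "u \<in> C \<union> N" if "u \<in> nb v" for u
        proof (rule ccontr)
          assume "u \<notin> C \<union> N"
          hence u: "u \<in> D" using that H by (auto simp: nb_def)
          have "E u v" using that sym[of u v] vV by (auto simp: nb_def)
          hence "v = s u" using E_D[OF u vV(1)] vV(2) u by auto
          thus False using vV(3) u by (auto simp: C_def)
        qed
        obtain u where u: "u \<in> V - {v}" "E u v" using no_iso vV(1) by blast
        hence un: "u \<in> nb v" using sym[of u v] vV by (auto simp: nb_def)
        have "nb v \<noteq> {u}" using vV by (auto simp: D_def)
        then obtain w where "w \<in> nb v" "w \<noteq> u" using un by blast
        thus ?thesis using un nbH by (auto simp: nb_def)
      qed
      have place: "cuttable V E k"
        if rep': "represents V E l' r'" and X: "X \<subseteq> l' ` (C \<union> N) \<union> r' ` (C \<union> N)"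
          and hit_C: "\<And>c. c \<in> C \<Longrightarrow> l' c \<in> X \<or> r' c \<in> X"
          and hit_N: "\<And>v. v \<in> N \<Longrightarrow> (\<exists>x\<in>X. l' v \<le> x \<and> x \<le> r' v) \<and> (\<exists>x\<in>X. x \<le> l' v \<or> r' v \<le> x)"
          and "card X \<le> k" for l' r' X
      proof -
        have "cuttable (D \<union> (C \<union> N)) E k"
        proof (rule cuttable_pendants)
          show "represents (C \<union> N) E l' r'" by (rule represents_subset[OF rep' H(4)])
          show "s ` D \<subseteq> C \<union> N" by (auto simp: C_def)
          show "(E d w \<longleftrightarrow> w = s d) \<and> (E w d \<longleftrightarrow> w = s d)"
            if "d \<in> D" "w \<in> D \<union> (C \<union> N)" "w \<noteq> d" for d w
            using that E_D[of d w] sym[of w d] D_V H(1) by auto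
          show "l' (s d) \<in> X \<or> r' (s d) \<in> X" if "d \<in> D" for d
            using that hit_C by (auto simp: C_def)
          have less: "l' v < r' v" if "v \<in> C \<union> N" for v
            using chord_diagramD(1)[of V l' r' v v] rep' that H(4)
            by (auto simp: represents_def)
          show "\<exists>x\<in>X. l' v \<le> x \<and> x \<le> r' v" if "v \<in> C \<union> N" for v
          proof (cases "v \<in> C")
            case True
            thus ?thesis using hit_C[OF True] less[OF that] by (meson less_imp_le order_refl)
          qed (use that hit_N in blast)
          show "\<exists>x\<in>X. x \<le> l' v \<or> r' v \<le> x" if "v \<in> C \<union> N" for v
          proof (cases "v \<in> C")
            case True
            thus ?thesis using hit_C[OF True] by (meson order_refl)
          qed (use that hit_N in blast)
        qed (use X \<open>card X \<le> k\<close> fins H inj less.prems(4) in auto)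
        thus ?thesis using H(1) by simp
      qed
      show ?thesis
      proof (cases "N = {}")
        case True
        have "card (l ` C) \<le> k" using card_image_le[OF fins(1), of l] card True by simp
        thus ?thesis using True by (intro place[OF rep, of "l ` C"]) auto
      next
        case False
        then obtain p where p: "p \<in> N" by blast
        hence pV: "p \<in> V" by (auto simp: N_def)
        \<comment> \<open>The origin moves to the left end of an arbitrary \<open>p\<close> in
          \<open>N\<close>, so that this end becomes the leftmost one.\<close>
        obtain M l' r' where rot: "represents V E l' r'"
          "\<And>v. v \<in> V \<Longrightarrow> l p \<le> l' v \<and> {l' v, r' v} = {turn (l p) M (l v), turn (l p) M (r v)}"
          using rotate[OF rep fin, of "{}" "l p"] by (metis finite.emptyI)
        have dia: "chord_diagram V l' r'" using rot(1) by (simp add: represents_def)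
        have "l p < r p" using rep pV by (auto simp: represents_def chord_diagram_iff)
        hence "{l' p, r' p} = {l p, r p}" using rot(2)[OF pV] by (simp add: turn_def)
        hence "l' p = l p"
          using chord_diagramD(1)[OF dia pV pV] \<open>l p < r p\<close> by (auto simp: doubleton_eq_iff)
        hence least: "l' p \<le> l' v" if "v \<in> C \<union> N" for v using rot(2)[of v] that H(4) by auto
        have "\<exists>X \<subseteq> l' ` (C \<union> N) \<union> r' ` (C \<union> N). (\<forall>c\<in>C. l' c \<in> X \<or> r' c \<in> X) \<and>
          (\<forall>v\<in>N. (\<exists>x\<in>X. l' v \<le> x \<and> x \<le> r' v) \<and> (\<exists>x\<in>X. x \<le> l' v \<or> r' v \<le> x)) \<and>
          2 * card X \<le> 2 * card C + card N + 1"
        proof (rule stabbing_ends[where p = p])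
          show "l' p \<le> l' v" if "v \<in> C \<union> N" for v by (rule least[OF that])
          show "chord_diagram (C \<union> N) l' r'"
            using represents_subset[OF rot(1) H(4)] by (simp add: represents_def)
          fix v assume v: "v \<in> N"
          obtain u w where uw: "u \<in> C \<union> N" "w \<in> C \<union> N" "u \<noteq> w" "u \<noteq> v" "w \<noteq> v" "E v u" "E v w"
            using two[OF v] by (elim bexE conjE)
          have "crosses l' r' v z" if "z \<in> C \<union> N" "z \<noteq> v" "E v z" for z
          proof -
            have "z \<in> V" "v \<in> V" using that v H(4) by auto
            thus ?thesis using rot(1) that by (simp add: represents_def)
          qed
          hence "crosses l' r' v u" "crosses l' r' v w" using uw by simp_all
          thus "\<exists>u\<in>C \<union> N. \<exists>w\<in>C \<union> N. u \<noteq> w \<and> u \<noteq> v \<and> w \<noteq> v \<and> crosses l' r' v u \<and> crosses l' r' v w"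
            using uw(1-5) by (intro bexI conjI)
        qed (use fins H(3) p in auto)
        then obtain X where X: "X \<subseteq> l' ` (C \<union> N) \<union> r' ` (C \<union> N)" "\<And>c. c \<in> C \<Longrightarrow> l' c \<in> X \<or> r' c \<in> X"
          "\<And>v. v \<in> N \<Longrightarrow> (\<exists>x\<in>X. l' v \<le> x \<and> x \<le> r' v) \<and> (\<exists>x\<in>X. x \<le> l' v \<or> r' v \<le> x)"
          "2 * card X \<le> 2 * card C + card N + 1" by metis
        \<comment> \<open>So far \<open>2 * card X\<close> is at most \<open>2 * k + 1\<close>; the
          odd unit disappears on halving.\<close>
        have "card X \<le> k" using X(4) card by linarith
        thus ?thesis using place[OF rot(1) X(1-3)] by blast
      qed
    qed
  qed
qed

section \<open>Segments in convex position\<close>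

text \<open>The cross product of \<open>b - a\<close> and \<open>c - a\<close>: twice the signed
  area of the triangle, positive for a left turn.\<close>

definition orient :: "complex \<Rightarrow> complex \<Rightarrow> complex \<Rightarrow> real" where
  "orient a b c = (Re b - Re a) * (Im c - Im a) - (Im b - Im a) * (Re c - Re a)"

lemma orient_cyclic: "orient b c a = orient a b c"
  and orient_swap: "orient a c b = - orient a b c"
  by (simp_all add: orient_def algebra_simps)

lemma orient_affine:
  "orient a b ((1 - t) *\<^sub>R c + t *\<^sub>R d) = (1 - t) * orient a b c + t * orient a b d"
  by (simp add: orient_def algebra_simps)

lemma segments_disjoint:
  assumes "0 < orient a b c * orient a b d"
  shows "closed_segment a b \<inter> closed_segment c d = {}"
proof (rule ccontr)
  assume "closed_segment a b \<inter> closed_segment c d \<noteq> {}"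
  then obtain s t where st: "0 \<le> t" "t \<le> 1" "(1 - s) *\<^sub>R a + s *\<^sub>R b = (1 - t) *\<^sub>R c + t *\<^sub>R d"
    by (auto simp: in_segment)
  have "orient a b ((1 - s) *\<^sub>R a + s *\<^sub>R b) = 0"
    unfolding orient_affine by (simp add: orient_def)
  hence *: "(1 - t) * orient a b c + t * orient a b d = 0"
    unfolding st(3) orient_affine .
  consider "0 < orient a b c" "0 < orient a b d" | "orient a b c < 0" "orient a b d < 0"
    using assms by (auto simp: zero_less_mult_iff)
  thus False
  proof cases
    case 1
    have "0 < (1 - t) * orient a b c + t * orient a b d"
      using 1 st(1,2) by (cases "t = 0") (auto intro!: add_nonneg_pos)
    thus False using * by simp
  next
    case 2
    have "(1 - t) * orient a b c + t * orient a b d < 0"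
      using 2 st(1,2) by (cases "t = 0") (auto intro!: add_nonpos_neg simp: mult_nonneg_nonpos mult_pos_neg)
    thus False using * by simp
  qed
qed

lemma segments_meet:
  assumes "orient a b c * orient a b d < 0" "orient c d a * orient c d b < 0"
  shows "closed_segment a b \<inter> closed_segment c d \<noteq> {}"
proof -
  \<comment> \<open>Up to sign \<open>W\<close> is the determinant of the directions
    \<open>b - a\<close> and \<open>d - c\<close>, and \<open>s\<close> and \<open>t\<close> are the
    parameters that Cramer's rule gives for the common point.\<close>
  define W where "W = orient a b c - orient a b d"
  define t where "t = orient a b c / W"
  define s where "s = - orient c d a / W"
  have W': "W = orient c d b - orient c d a"
    by (simp add: W_def orient_def algebra_simps)
  have 01: "x \<noteq> y \<and> 0 \<le> x / (x - y) \<and> x / (x - y) \<le> 1" if "x * y < 0" for x y :: real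
    using that by (cases "x < 0") (auto simp: mult_less_0_iff divide_simps)
  have t: "0 \<le> t" "t \<le> 1" and "W \<noteq> 0"
    using 01[OF assms(1)] by (auto simp: t_def W_def)
  have s: "0 \<le> s" "s \<le> 1"
    using 01[OF assms(2)] unfolding s_def W'
    by (metis minus_diff_eq minus_divide_divide minus_minus)+
  have "(1 - s) *\<^sub>R a + s *\<^sub>R b = (1 - t) *\<^sub>R c + t *\<^sub>R d"
  proof -
    have "W * (Re a - Re c) = orient c d a * (Re b - Re a) + orient a b c * (Re d - Re c)"
      "W * (Im a - Im c) = orient c d a * (Im b - Im a) + orient a b c * (Im d - Im c)"
      unfolding W_def orient_def by algebra+
    moreover have "orient a b c = W * t" "orient c d a = - (W * s)"
      using \<open>W \<noteq> 0\<close> by (simp_all add: t_def s_def)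
    ultimately have "W * (Re a - Re c) = W * (t * (Re d - Re c) - s * (Re b - Re a))"
      "W * (Im a - Im c) = W * (t * (Im d - Im c) - s * (Im b - Im a))"
      by (simp_all add: right_diff_distrib mult.assoc)
    hence "Re a - Re c = t * (Re d - Re c) - s * (Re b - Re a)"
      "Im a - Im c = t * (Im d - Im c) - s * (Im b - Im a)"
      using \<open>W \<noteq> 0\<close> mult_left_cancel by blast+
    thus ?thesis by (intro complex_eqI) (simp_all add: algebra_simps)
  qed
  hence "(1 - s) *\<^sub>R a + s *\<^sub>R b \<in> closed_segment a b \<inter> closed_segment c d"
    using s t by (auto simp: in_segment)
  thus ?thesis by blast
qed

text \<open>On a convex curve run through counterclockwise, points between \<open>a\<close> and
  \<open>b\<close> lie to the right of the directed line from \<open>f a\<close> to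
  \<open>f b\<close>, the others to the left. This common interface serves both the circle and the
  polygon.\<close>

definition convex_side :: "(real \<Rightarrow> complex) \<Rightarrow> real \<Rightarrow> real \<Rightarrow> real \<Rightarrow> bool" where
  "convex_side f a b t \<longleftrightarrow>
     (a < t \<and> t < b \<longrightarrow> orient (f a) (f b) (f t) < 0) \<and> (t < a \<or> b < t \<longrightarrow> 0 < orient (f a) (f b) (f t))"

lemma segments_meet_iff:
  assumes "a < b" "c < d" "a \<noteq> c" "a \<noteq> d" "b \<noteq> c" "b \<noteq> d"
    and "convex_side f a b c" "convex_side f a b d" "convex_side f c d a" "convex_side f c d b"
  shows "closed_segment (f a) (f b) \<inter> closed_segment (f c) (f d) \<noteq> {} \<longleftrightarrow>
    a < c \<and> c < b \<and> b < d \<or> c < a \<and> a < d \<and> d < b"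
proof -
  consider "a < c" "c < b" "b < d" | "c < a" "a < d" "d < b" |
    "(a < c \<and> c < b) = (a < d \<and> d < b)"
    using assms(1-6) by linarith
  thus ?thesis
  proof cases
    case 1
    hence "orient (f a) (f b) (f c) < 0" "0 < orient (f a) (f b) (f d)"
      "0 < orient (f c) (f d) (f a)" "orient (f c) (f d) (f b) < 0"
      using assms by (auto simp: convex_side_def)
    thus ?thesis using 1 segments_meet[of "f a" "f b" "f c" "f d"] by (simp add: mult_less_0_iff)
  next
    case 2
    hence "orient (f a) (f b) (f d) < 0" "0 < orient (f a) (f b) (f c)"
      "0 < orient (f c) (f d) (f b)" "orient (f c) (f d) (f a) < 0"
      using assms by (auto simp: convex_side_def)
    thus ?thesis using 2 segments_meet[of "f a" "f b" "f c" "f d"] by (simp add: mult_less_0_iff)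
  next
    case 3
    have "0 < orient (f a) (f b) (f c) * orient (f a) (f b) (f d)"
    proof (cases "a < c \<and> c < b")
      case True
      thus ?thesis using 3 assms(7,8) by (simp add: convex_side_def mult_neg_neg)
    next
      case False
      hence "c < a \<or> b < c" "d < a \<or> b < d" using 3 assms(2-6) by linarith+
      thus ?thesis using assms(7,8) by (simp add: convex_side_def)
    qed
    hence "closed_segment (f a) (f b) \<inter> closed_segment (f c) (f d) = {}"
      by (rule segments_disjoint)
    moreover have "\<not> (a < c \<and> c < b \<and> b < d \<or> c < a \<and> a < d \<and> d < b)"
      using 3 by linarith
    ultimately show ?thesis by blast
  qed
qed

text \<open>The product form shows the sign: for angles in \<open>[0, 2 * pi)\<close> each factor
  has the sign of the corresponding difference. It is the identity sin 2x + sin 2y - sin 2(x + y) =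
  4 sin x sin y sin (x + y).\<close>

lemma orient_circle:
  fixes z :: complex
  shows "orient (z + r *\<^sub>R cis a) (z + r *\<^sub>R cis b) (z + r *\<^sub>R cis c) =
    4 * r\<^sup>2 * (sin ((b - a) / 2) * sin ((c - b) / 2) * sin ((c - a) / 2))"
proof -
  define x y where "x = (b - a) / 2" and "y = (c - b) / 2"
  have bc: "b = a + 2 * x" "c = a + 2 * (x + y)" "(c - a) / 2 = x + y"
    by (auto simp: x_def y_def field_simps)
  have "orient (z + r *\<^sub>R cis a) (z + r *\<^sub>R cis b) (z + r *\<^sub>R cis c) =
     r\<^sup>2 * (sin (b - a) + sin (c - b) - sin (c - a))"
    by (simp add: orient_def sin_diff power2_eq_square algebra_simps)
  also have "sin (b - a) + sin (c - b) - sin (c - a) = sin (2 * x) + sin (2 * y) - sin (2 * (x + y))"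
    by (simp add: bc(1,2) algebra_simps)
  also have "\<dots> = 4 * (sin x * sin y * sin (x + y))"
  proof -
    have "sin (2 * (x + y)) = 2 * (sin x * cos y + cos x * sin y) * (cos x * cos y - sin x * sin y)"
      by (simp only: sin_double sin_add cos_add)
    also have "\<dots> = 2 * sin x * cos x * ((cos y)\<^sup>2 - (sin y)\<^sup>2) + 2 * sin y * cos y * ((cos x)\<^sup>2 - (sin x)\<^sup>2)"
      by (simp add: power2_eq_square algebra_simps)
    also have "\<dots> = 2 * sin x * cos x * (1 - 2 * (sin y)\<^sup>2) + 2 * sin y * cos y * (1 - 2 * (sin x)\<^sup>2)"
      by (simp add: cos_squared_eq)
    finally have double: "sin (2 * (x + y)) = 2 * sin x * cos x * (1 - 2 * (sin y)\<^sup>2) +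
      2 * sin y * cos y * (1 - 2 * (sin x)\<^sup>2)" .
    show ?thesis
      unfolding double unfolding sin_double sin_add by (simp add: power2_eq_square algebra_simps)
  qed
  finally show ?thesis by (simp add: bc(3) x_def[symmetric] y_def[symmetric])
qed

lemma convex_side_circle:
  assumes "0 < r" "0 \<le> a" "a < b" "b < 2 * pi" "0 \<le> t" "t < 2 * pi"
  shows "convex_side (\<lambda>\<theta>. z + r *\<^sub>R cis \<theta>) a b t"
proof -
  have pos: "0 < sin ((y - x) / 2)" if "x < y" "0 \<le> x" "y < 2 * pi" for x y :: real
    using that by (intro sin_gt_zero) auto
  have neg: "sin ((x - y) / 2) < 0" if "x < y" "0 \<le> x" "y < 2 * pi" for x y :: real
  proof -
    have "(x - y) / 2 = - ((y - x) / 2)" by (metis minus_diff_eq minus_divide_left)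
    hence "sin ((x - y) / 2) = - sin ((y - x) / 2)" by (simp only: sin_minus)
    thus ?thesis using pos[OF that] by simp
  qed
  have "0 < 4 * r\<^sup>2" using assms by simp
  moreover have "sin ((b - a) / 2) * sin ((t - b) / 2) * sin ((t - a) / 2) < 0" if "a < t" "t < b"
    using that assms pos[of a b] pos[of a t] neg[of t b] by (simp add: mult_less_0_iff)
  moreover have "0 < sin ((b - a) / 2) * sin ((t - b) / 2) * sin ((t - a) / 2)" if "t < a \<or> b < t"
    using that
  proof
    assume "t < a"
    thus ?thesis using assms pos[of a b] neg[of t a] neg[of t b] by (simp add: mult_neg_neg mult_pos_neg)
  next
    assume "b < t"
    thus ?thesis using assms pos[of a b] pos[of a t] pos[of b t] by simp
  qed
  ultimately show ?thesis
    unfolding convex_side_def orient_circle by (meson mult_pos_neg mult_pos_pos)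
qed

section \<open>Order along the boundary of a polygon\<close>

text \<open>
  The polygon has its corners on a parabola; \<open>boundary_point k\<close> runs once around its boundary, with
  \<open>side k j\<close> parametrized by \<open>[j, j + 1]\<close>.
\<close>
definition corner :: "nat \<Rightarrow> complex" where
  "corner j = Complex (real j) ((real j)\<^sup>2)"

definition side :: "nat \<Rightarrow> nat \<Rightarrow> complex set" where
  "side k j = closed_segment (corner j) (corner (Suc j mod k))"

text \<open>The line through \<open>corner j\<close> and \<open>corner (j + 1)\<close>: a secant of
  the parabola, but a supporting line of the polygon, which lies above it.\<close>

definition tangent_line :: "int \<Rightarrow> real \<Rightarrow> real" where
  "tangent_line j x = (2 * of_int j + 1) * x - of_int j * (of_int j + 1)"

definition boundary_point :: "nat \<Rightarrow> real \<Rightarrow> complex" where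
  "boundary_point k u = (if u \<le> real k - 1 then Complex u (tangent_line \<lfloor>u\<rfloor> u)
     else Complex ((real k - 1) * (real k - u)) ((real k - 1)\<^sup>2 * (real k - u)))"

text \<open>Vertical shears preserve signed area, so heights may be measured from any line
  \<open>p * x + q\<close>.\<close>

lemma orient_shear:
  "orient (Complex a (p * a + q + a')) (Complex b (p * b + q + b')) (Complex c (p * c + q + c')) =
    (b - a) * (c' - a') - (b' - a') * (c - a)"
  by (simp add: orient_def algebra_simps)

lemma orient_above_line:
  assumes "a < b" "b < c" "y = p * b + q" "p * a + q \<le> x" "p * c + q \<le> z"
    "p * a + q < x \<or> p * c + q < z"
  shows "0 < orient (Complex a x) (Complex b y) (Complex c z)"
proof -
  define a' c' where "a' = x - (p * a + q)" and "c' = z - (p * c + q)"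
  have "orient (Complex a x) (Complex b y) (Complex c z) = (b - a) * c' + (c - b) * a'"
    using orient_shear[of a p q a' b 0 c c'] assms(3) by (simp add: a'_def c'_def algebra_simps)
  moreover have "0 \<le> a'" "0 \<le> c'" "0 < a' \<or> 0 < c'"
    using assms by (auto simp: a'_def c'_def)
  ultimately show ?thesis
    using assms(1,2) by (auto intro: add_nonneg_pos add_pos_nonneg)
qed

text \<open>The lower boundary interpolates a convex function at the integers, hence it is the
  maximum of all its side lines, attained only once away from the integers.\<close>

lemma tangent_line_le:
  assumes "u \<notin> \<int>" "j \<noteq> \<lfloor>u\<rfloor>"
  shows "tangent_line j u < tangent_line \<lfloor>u\<rfloor> u"
proof -
  define i where "i = \<lfloor>u\<rfloor>"
  have "of_int i \<noteq> u" using assms(1) Ints_of_int by metis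
  hence u: "of_int i < u" "u < of_int i + 1"
    using floor_correct[of u] unfolding i_def by linarith+
  have eq: "tangent_line i u - tangent_line j u = (of_int i - of_int j) * (2 * u - of_int i - of_int j - 1)"
    by (simp add: tangent_line_def algebra_simps)
  have "0 < (of_int i - of_int j) * (2 * u - of_int i - of_int j - (1::real))"
  proof (cases "j < i")
    case True
    hence "real_of_int j + 1 \<le> of_int i" by linarith
    thus ?thesis using u by (intro mult_pos_pos) auto
  next
    case False
    hence "real_of_int i + 1 \<le> of_int j" using assms(2) i_def by linarith
    thus ?thesis using u by (intro mult_neg_neg) auto
  qed
  thus ?thesis using eq by (simp add: i_def)
qed

lemma tangent_line_less_top:
  assumes "0 < u" "u < real k - 1" "3 \<le> k"
  shows "tangent_line \<lfloor>u\<rfloor> u < (real k - 1) * u"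
proof -
  define j :: real where "j = of_int \<lfloor>u\<rfloor>"
  have u: "j \<le> u" "u < j + 1" by (simp_all add: j_def)
  have "\<lfloor>u\<rfloor> < int k - 1" using assms(2) by (simp add: floor_less_iff)
  hence jk: "j \<le> real k - 2" unfolding j_def by linarith
  have "0 \<le> \<lfloor>u\<rfloor>" using assms(1) by simp
  hence "\<lfloor>u\<rfloor> = 0 \<or> 1 \<le> \<lfloor>u\<rfloor>" by linarith
  hence j0: "j = 0 \<or> 1 \<le> j" unfolding j_def by auto
  \<comment> \<open>A weighted mean of the distances below the top line at the corners
    \<open>j\<close> and \<open>j + 1\<close>, with weights \<open>j + 1 - u\<close> and
    \<open>u - j\<close>.\<close>
  have eq: "(real k - 1) * u - tangent_line \<lfloor>u\<rfloor> u =
    (j + 1 - u) * (j * (real k - 1 - j)) + (u - j) * ((j + 1) * (real k - 2 - j))"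
    unfolding tangent_line_def j_def[symmetric] by (simp add: algebra_simps)
  have "0 < (j + 1 - u) * (j * (real k - 1 - j)) + (u - j) * ((j + 1) * (real k - 2 - j))"
    using j0
  proof
    assume "j = 0"
    thus ?thesis using assms by simp
  next
    assume "1 \<le> j"
    thus ?thesis using u jk by (intro add_pos_nonneg mult_pos_pos mult_nonneg_nonneg) auto
  qed
  thus ?thesis using eq by simp
qed

text \<open>The boundary is run through counterclockwise, so three points in order turn left unless
  one side contains them all. Non-integer parameters keep them off the corners, where the floor
  would name only one of two sides.\<close>

lemma orient_boundary_point:
  assumes k: "3 \<le> k" and uvw: "0 < u" "u < v" "v < w" "w < real k"
    and int: "u \<notin> \<int>" "v \<notin> \<int>" "w \<notin> \<int>"
    and sides: "\<lfloor>u\<rfloor> \<noteq> \<lfloor>v\<rfloor> \<or> \<lfloor>v\<rfloor> \<noteq> \<lfloor>w\<rfloor>"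
  shows "0 < orient (boundary_point k u) (boundary_point k v) (boundary_point k w)"
proof -
  let ?K = "real k - 1"
  let ?g = "\<lambda>x. tangent_line \<lfloor>x\<rfloor> x"
  have line: "tangent_line j x = (2 * of_int j + 1) * x + (- of_int j * (of_int j + 1))" for j x
    by (simp add: tangent_line_def)
  have le: "tangent_line j x \<le> ?g x" for j x
  proof (cases "x \<in> \<int>")
    case True
    then obtain i where "x = of_int i" by (elim Ints_cases)
    moreover have "0 \<le> (i - j) * (i - j - 1)"
      by (cases "i \<le> j") (auto intro: mult_nonneg_nonneg mult_nonpos_nonpos)
    hence "0 \<le> real_of_int ((i - j) * (i - j - 1))" by linarith
    ultimately show ?thesis by (simp add: tangent_line_def algebra_simps)
  qed (use tangent_line_le[of x j] in \<open>cases "j = \<lfloor>x\<rfloor>"; simp\<close>)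
  have K: "real_of_int (int k - 1) = ?K" using k by simp
  have nK: "x \<noteq> ?K" if "x \<notin> \<int>" for x using that K Ints_of_int by metis
  \<comment> \<open>The cases count how many of the points lie on the top side, the part of the line
    \<open>?K * x\<close> that leads back to \<open>corner 0\<close>.\<close>
  consider "w \<le> ?K" | "v \<le> ?K" "?K < w" | "u \<le> ?K" "?K < v" | "?K < u" by linarith
  thus ?thesis
  proof cases
    case 1
    have "0 < orient (Complex u (?g u)) (Complex v (?g v)) (Complex w (?g w))"
    proof (rule orient_above_line[where p = "2 * of_int \<lfloor>v\<rfloor> + 1" and q = "- of_int \<lfloor>v\<rfloor> * (of_int \<lfloor>v\<rfloor> + 1)"];
        (fold line)?)
      show "tangent_line \<lfloor>v\<rfloor> u < ?g u \<or> tangent_line \<lfloor>v\<rfloor> w < ?g w"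
        using tangent_line_le[of u "\<lfloor>v\<rfloor>"] tangent_line_le[of w "\<lfloor>v\<rfloor>"] int sides by metis
    qed (use uvw le in auto)
    thus ?thesis using 1 uvw by (simp add: boundary_point_def)
  next
    case 2
    define X where "X = ?K * (real k - w)"
    have X: "0 < X" "X < ?K" using 2 uvw k by (auto simp: X_def)
    have w: "boundary_point k w = Complex X (?K * X)"
      using 2 by (simp add: boundary_point_def X_def power2_eq_square mult.assoc)
    have top: "?g x < ?K * x" if "0 < x" "x < ?K" for x
      using tangent_line_less_top[of x k] that k by simp
    have vK: "v < ?K" using 2 nK int by force
    have above: "tangent_line j X < ?K * X" for j using top[OF X] le[of j X] by simp
    have "0 < orient (Complex u (?g u)) (Complex v (?g v)) (Complex X (?K * X))"
    proof -
      consider "v < X" | "X < u" | "X = u" | "X = v" | "u < X" "X < v" by linarith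
      thus ?thesis
      proof cases
        case 1
        show ?thesis
          by (rule orient_above_line[where p = "2 * of_int \<lfloor>v\<rfloor> + 1" and q = "- of_int \<lfloor>v\<rfloor> * (of_int \<lfloor>v\<rfloor> + 1)"];
            (fold line)?) (use 1 uvw le above in \<open>auto intro: less_imp_le\<close>)
      next
        case 2
        have "0 < orient (Complex X (?K * X)) (Complex u (?g u)) (Complex v (?g v))"
          by (rule orient_above_line[where p = "2 * of_int \<lfloor>u\<rfloor> + 1" and q = "- of_int \<lfloor>u\<rfloor> * (of_int \<lfloor>u\<rfloor> + 1)"];
            (fold line)?) (use 2 uvw le above in \<open>auto intro: less_imp_le\<close>)
        thus ?thesis by (simp add: orient_cyclic)
      next
        case 3
        thus ?thesis using above[of "\<lfloor>u\<rfloor>"] uvw by (simp add: orient_def)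
      next
        case 4
        thus ?thesis using above[of "\<lfloor>v\<rfloor>"] uvw
          by (simp add: orient_def left_diff_distrib[symmetric] right_diff_distrib[symmetric] mult.commute)
      next
        case 5
        \<comment> \<open>Here the point on the top side has the middle abscissa, so depths below
          the top line are used instead of heights above a lower side.\<close>
        define a' b' where "a' = ?K * u - ?g u" and "b' = ?K * v - ?g v"
        have "0 < a'" "0 < b'" using top[of u] top[of v] uvw vK by (auto simp: a'_def b'_def)
        moreover have "orient (Complex u (?g u)) (Complex v (?g v)) (Complex X (?K * X)) =
          (v - X) * a' + (X - u) * b'"
          using orient_shear[of u ?K 0 "- a'" v "- b'" X 0] by (simp add: a'_def b'_def algebra_simps)
        ultimately show ?thesis using 5 by (simp add: add_pos_pos)
      qed
    qed
    thus ?thesis using 2 uvw w by (simp add: boundary_point_def)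
  next
    case 3
    have uK: "u < ?K" using 3 nK int by force
    define X Y where "X = ?K * (real k - v)" and "Y = ?K * (real k - w)"
    have vw: "boundary_point k v = Complex X (?K * X)" "boundary_point k w = Complex Y (?K * Y)"
      using 3 uvw by (simp_all add: boundary_point_def X_def Y_def power2_eq_square mult.assoc)
    have "Y < X" using uvw k by (simp add: X_def Y_def)
    moreover have "?g u < ?K * u" using tangent_line_less_top[of u k] uK uvw k by simp
    moreover have "orient (Complex u (?g u)) (Complex X (?K * X)) (Complex Y (?K * Y)) =
      (X - Y) * (?K * u - ?g u)"
      using orient_shear[of u ?K 0 "?g u - ?K * u" X 0 Y 0] by (simp add: algebra_simps)
    ultimately show ?thesis using 3 vw by (simp add: boundary_point_def)
  next
    case 4
    have "\<lfloor>x\<rfloor> = int k - 1" if "?K < x" "x < real k" for x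
      using that by (intro floor_unique) auto
    thus ?thesis using 4 sides uvw by simp
  qed
qed

lemma convex_side_boundary_point:
  assumes k: "3 \<le> k" and "0 < a" "a < b" "b < real k" "0 < t" "t < real k" "t \<noteq> a" "t \<noteq> b"
    and int: "a \<notin> \<int>" "b \<notin> \<int>" "t \<notin> \<int>" and sides: "\<lfloor>a\<rfloor> \<noteq> \<lfloor>b\<rfloor>"
  shows "convex_side (boundary_point k) a b t"
proof -
  let ?f = "boundary_point k"
  have "orient (?f a) (?f b) (?f t) < 0" if "a < t" "t < b"
  proof -
    have "0 < orient (?f a) (?f t) (?f b)"
      using that assms by (intro orient_boundary_point) auto
    thus ?thesis using orient_swap[of "?f a" "?f b" "?f t"] by simp
  qed
  moreover have "0 < orient (?f a) (?f b) (?f t)" if "t < a"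
  proof -
    have "0 < orient (?f t) (?f a) (?f b)"
      using that assms by (intro orient_boundary_point) auto
    thus ?thesis by (simp add: orient_cyclic)
  qed
  moreover have "0 < orient (?f a) (?f b) (?f t)" if "b < t"
    using that assms by (intro orient_boundary_point) auto
  ultimately show ?thesis by (auto simp: convex_side_def)
qed

lemma boundary_point_in_side:
  assumes "2 \<le> k" "0 < u" "u < real k"
  shows "boundary_point k u \<in> side k (nat \<lfloor>u\<rfloor>)" "nat \<lfloor>u\<rfloor> < k"
proof -
  define j where "j = nat \<lfloor>u\<rfloor>"
  define s where "s = u - real j"
  have "0 \<le> \<lfloor>u\<rfloor>" using assms by simp
  hence j: "real j = of_int \<lfloor>u\<rfloor>" by (simp add: j_def)
  have s: "0 \<le> s" "s \<le> 1" "u = real j + s"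
    using floor_correct[of u] unfolding s_def j by linarith+
  show "nat \<lfloor>u\<rfloor> < k"
    using assms \<open>0 \<le> \<lfloor>u\<rfloor>\<close> by (simp add: nat_less_iff floor_less_iff)
  hence jk: "j < k" by (simp add: j_def)
  have "boundary_point k u = (1 - s) *\<^sub>R corner j + s *\<^sub>R corner (Suc j mod k)"
  proof (cases "Suc j = k")
    case True
    hence k: "real k = real j + 1" by simp
    \<comment> \<open>At \<open>u = k - 1\<close> the first branch of \<open>boundary_point\<close>
      applies although the side is the last one; both give \<open>corner j\<close>.\<close>
    show ?thesis
    proof (cases "s = 0")
      case True
      thus ?thesis using s k \<open>Suc j = k\<close> by (simp add: boundary_point_def corner_def tangent_line_def
          power2_eq_square algebra_simps complex_eq_iff flip: j)
    next
      case False
      have "real k - 1 = real j" "real k - u = 1 - s" "\<not> u \<le> real j" "Suc j mod k = 0"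
        using s k False \<open>Suc j = k\<close> by auto
      thus ?thesis by (simp add: boundary_point_def corner_def complex_eq_iff)
    qed
  next
    case False
    hence "Suc j < k" using jk by simp
    hence "u \<le> real k - 1" using s by linarith
    thus ?thesis using \<open>Suc j < k\<close> s(3) unfolding boundary_point_def tangent_line_def j[symmetric]
      by (simp add: corner_def power2_eq_square algebra_simps complex_eq_iff)
  qed
  thus "boundary_point k u \<in> side k (nat \<lfloor>u\<rfloor>)"
    unfolding side_def j_def[symmetric] using s by (auto simp: in_segment)
qed

section \<open>Sides and faces of the polygon\<close>

definition polygon :: "nat \<Rightarrow> complex set" where
  "polygon k = convex hull (corner ` {..<k})"

lemma corner_eq_iff [simp]: "corner i = corner j \<longleftrightarrow> i = j"
  by (simp add: corner_def)

lemma orient_corner: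
  "orient (corner i) (corner j) (corner l) =
    (real j - real i) * (real l - real j) * (real l - real i)"
  by (simp add: orient_def corner_def power2_eq_square algebra_simps)

lemma side_eq_iff:
  assumes "3 \<le> k" "i < k" "j < k"
  shows "side k i = side k j \<longleftrightarrow> i = j"
proof
  assume "side k i = side k j"
  hence "{i, Suc i mod k} = {j, Suc j mod k}"
    unfolding side_def closed_segment_eq by (auto simp: doubleton_eq_iff)
  thus "i = j"
    using assms by (auto simp: doubleton_eq_iff mod_Suc split: if_splits)
qed simp

lemma hull_face_eq_segment:
  fixes S :: "'a::euclidean_space set"
  assumes "finite S" "x \<in> S" "y \<in> S"
    and ge: "\<And>z. z \<in> S \<Longrightarrow> b \<le> a \<bullet> z" and eq: "\<And>z. z \<in> S \<Longrightarrow> a \<bullet> z = b \<longleftrightarrow> z = x \<or> z = y"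
  shows "closed_segment x y face_of convex hull S"
proof -
  let ?T = "convex hull S \<inter> {z. a \<bullet> z = b}"
  have "convex hull S \<subseteq> {z. b \<le> a \<bullet> z}"
    using ge by (intro hull_minimal) (auto simp: convex_halfspace_ge)
  hence face: "?T face_of convex hull S"
    by (intro face_of_Int_supporting_hyperplane_ge convex_convex_hull) auto
  then obtain S' where S': "S' \<subseteq> S" "?T = convex hull S'"
    using face_of_convex_hull_subset[OF finite_imp_compact[OF \<open>finite S\<close>]] by blast
  have "S' \<subseteq> ?T" unfolding S'(2) by (rule hull_subset)
  hence "S' \<subseteq> {x, y}" using S'(1) eq by blast
  hence "?T \<subseteq> closed_segment x y"
    unfolding S'(2) segment_convex_hull by (rule hull_mono)
  moreover have "x \<in> ?T" "y \<in> ?T" using assms by (auto intro: hull_inc)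
  hence "closed_segment x y \<subseteq> ?T"
    using face_of_imp_convex[OF face] by (intro closed_segment_subset)
  ultimately show ?thesis using face by (metis subset_antisym)
qed

text \<open>A functional normal to the side takes at \<open>corner i\<close> the value
  \<open>(i - j) * (i - j - 1)\<close> up to a constant, or \<open>i * (j - i)\<close> for the
  closing side. At the indices that occur these are nonnegative and vanish only at the two
  ends.\<close>

lemma side_face_of_polygon:
  assumes "3 \<le> k" "j < k"
  shows "side k j face_of polygon k"
proof (cases "Suc j = k")
  case True
  have nonneg: "0 \<le> real i * (real j - real i)" "real i * (real j - real i) = 0 \<longleftrightarrow> i = j \<or> i = 0"
    if "i < k" for i
    using that True by auto
  have "a = Complex (real j) (-1) \<Longrightarrow> a \<bullet> corner i = real i * (real j - real i)" for a i
    by (simp add: inner_complex_def corner_def power2_eq_square algebra_simps)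
  hence *: "Complex (real j) (-1) \<bullet> corner i = real i * (real j - real i)" for i by blast
  have "closed_segment (corner j) (corner 0) face_of polygon k"
    unfolding polygon_def
    by (rule hull_face_eq_segment[where a = "Complex (real j) (-1)" and b = 0])
      (use assms nonneg in \<open>auto simp: *\<close>)
  thus ?thesis using True by (simp add: side_def)
next
  case False
  hence j: "Suc j < k" using assms by simp
  define a where "a = Complex (- (2 * real j + 1)) 1"
  define b where "b = - (real j * (real j + 1))"
  have *: "a \<bullet> corner i = b + (real i - real j) * (real i - real j - 1)" for i
    by (simp add: a_def b_def inner_complex_def corner_def power2_eq_square algebra_simps)
  have "0 \<le> (real i - real j) * (real i - real j - 1)" for i
    by (cases "i \<le> j") (auto intro!: mult_nonneg_nonneg mult_nonpos_nonpos)
  moreover have "(real i - real j) * (real i - real j - 1) = 0 \<longleftrightarrow> i = j \<or> i = Suc j" for i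
    by auto
  ultimately have "closed_segment (corner j) (corner (Suc j)) face_of polygon k"
    unfolding polygon_def using j
    by (intro hull_face_eq_segment[where a = a and b = b]) (auto simp: *)
  thus ?thesis using j by (simp add: side_def)
qed

text \<open>If the corners \<open>i\<close> and \<open>m\<close> are not adjacent, their diagonal is
  crossed by one that starts at the corner after \<open>i\<close>. The crossing point is in
  \<open>T\<close> and inside that second diagonal, so the face property puts the neighbour of
  \<open>corner i\<close> into \<open>T\<close>.\<close>

lemma face_of_polygon_contains_side:
  assumes k: "3 \<le> k" and T: "T face_of polygon k" and im: "i < m" "m < k"
    and inT: "corner i \<in> T" "corner m \<in> T"
  shows "\<exists>j<k. side k j \<subseteq> T"
proof -
  have seg: "closed_segment x y \<subseteq> T" if "x \<in> T" "y \<in> T" for x y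
    using face_of_imp_convex[OF T] that by (intro closed_segment_subset)
  consider "m = Suc i" | "i = 0" "Suc m = k" | "Suc i < m" "Suc m < k \<or> 0 < i" using im by linarith
  thus ?thesis
  proof cases
    case 1
    thus ?thesis using seg inT im by (intro exI[of _ i]) (auto simp: side_def)
  next
    case 2
    thus ?thesis using seg inT im by (intro exI[of _ m]) (auto simp: side_def)
  next
    case 3
    define n where "n = (if Suc m < k then Suc m else 0)"
    have n: "n < k" "m < n \<or> n < i" using 3 im by (auto simp: n_def)
    let ?c = "corner (Suc i)" and ?d = "corner n"
    have o: "orient (corner i) (corner m) ?c < 0" "0 < orient (corner i) (corner m) ?d"
      "orient ?c ?d (corner i) * orient ?c ?d (corner m) < 0"
      using 3 n unfolding orient_corner
      by (auto simp: mult_less_0_iff zero_less_mult_iff)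
    have "closed_segment (corner i) (corner m) \<inter> closed_segment ?c ?d \<noteq> {}"
      using o by (intro segments_meet) (auto simp: mult_neg_pos)
    then obtain x where x: "x \<in> closed_segment (corner i) (corner m)" "x \<in> closed_segment ?c ?d" by blast
    then obtain s where "x = (1 - s) *\<^sub>R corner i + s *\<^sub>R corner m" by (auto simp: in_segment)
    hence "orient (corner i) (corner m) x = 0" by (simp add: orient_affine) (simp add: orient_def)
    hence "x \<noteq> ?c" "x \<noteq> ?d" using o by auto
    hence "x \<in> open_segment ?c ?d" using x by (simp add: open_segment_def)
    moreover have "?c \<in> polygon k" "?d \<in> polygon k"
      using 3 im n by (auto simp: polygon_def intro!: hull_inc)
    moreover have "x \<in> T" using x seg inT by blast
    ultimately have "?c \<in> T" using T unfolding face_of_def by blast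
    thus ?thesis using seg inT im 3 by (intro exI[of _ i]) (auto simp: side_def)
  qed
qed

text \<open>An edge is spanned by corners, has at least two of them, and so contains a side; both
  are faces of dimension one, hence equal.\<close>

lemma edges_of_polygon:
  assumes k: "3 \<le> k"
  shows "{s. s edge_of polygon k} = side k ` {..<k}"
proof
  have dim: "aff_dim (side k j) = 1" if "j < k" for j
    using that k by (simp add: side_def segment_convex_hull aff_dim_convex_hull mod_Suc)
  show "side k ` {..<k} \<subseteq> {s. s edge_of polygon k}"
    using dim side_face_of_polygon[OF k] by (auto simp: edge_of_def)
  show "{s. s edge_of polygon k} \<subseteq> side k ` {..<k}"
  proof
    fix T assume "T \<in> {s. s edge_of polygon k}"
    hence T: "T face_of polygon k" "aff_dim T = 1" by (auto simp: edge_of_def)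
    then obtain S' where S': "S' \<subseteq> corner ` {..<k}" "T = convex hull S'"
      using face_of_convex_hull_subset[of "corner ` {..<k}" T] by (auto simp: polygon_def finite_imp_compact)
    have ST: "S' \<subseteq> T" unfolding S'(2) by (rule hull_subset)
    have "aff_dim S' = 1" using T(2) S'(2) by (simp add: aff_dim_convex_hull)
    hence "S' \<noteq> {}" "\<And>x. S' \<noteq> {x}" by auto
    then obtain x y where xy: "x \<in> S'" "y \<in> S'" "x \<noteq> y" by (metis ex_in_conv insertI1 subsetI subset_singletonD)
    then obtain i m where "i < k" "m < k" "i \<noteq> m" "corner i \<in> T" "corner m \<in> T"
      using S'(1) ST by blast
    then obtain j where j: "j < k" "side k j \<subseteq> T"
      using face_of_polygon_contains_side[OF k T(1)] by (metis linorder_neqE_nat)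
    have "side k j face_of T"
      by (rule face_of_subset[OF side_face_of_polygon[OF k j(1)] j(2) face_of_imp_subset[OF T(1)]])
    hence "side k j = T"
      using face_of_aff_dim_lt[OF face_of_imp_convex[OF T(1)]] T(2) dim[OF j(1)] by fastforce
    thus "T \<in> side k ` {..<k}" using j(1) by blast
  qed
qed

lemma polygon_properties:
  assumes k: "3 \<le> k"
  shows "polytope (polygon k)" "aff_dim (polygon k) = 2" "card {s. s edge_of polygon k} = k"
proof -
  show "polytope (polygon k)" by (simp add: polygon_def polytope_convex_hull)
  have "inj_on (side k) {..<k}" using side_eq_iff[OF k] by (auto intro: inj_onI)
  thus "card {s. s edge_of polygon k} = k" by (simp add: edges_of_polygon[OF k] card_image)
  \<comment> \<open>Two different faces of dimension one cannot both be the whole polygon, so its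
    dimension exceeds one.\<close>
  have "side k 0 \<noteq> side k 1" "side k 0 face_of polygon k" "side k 1 face_of polygon k"
    using k side_eq_iff[OF k, of 0 1] side_face_of_polygon[OF k] by auto
  moreover have dim: "aff_dim (side k 0) = 1" "aff_dim (side k 1) = 1"
  proof -
    have "{side k 0, side k 1} \<subseteq> {s. s edge_of polygon k}"
      unfolding edges_of_polygon[OF k] using k by auto
    thus "aff_dim (side k 0) = 1" "aff_dim (side k 1) = 1" by (simp_all add: edge_of_def)
  qed
  ultimately have "1 < aff_dim (polygon k)"
    by (metis face_of_aff_dim_lt convex_convex_hull polygon_def)
  moreover have "aff_dim (polygon k) \<le> 2" using aff_dim_le_DIM[of "polygon k"] by simp
  ultimately show "aff_dim (polygon k) = 2" by simp
qed

section \<open>From circle graphs to polygon graphs\<close>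

text \<open>\<open>with_proj\<close> makes tail and head the projections, so the vertex map of an
  isomorphism determines its arc map.\<close>

lemma graph_isoD:
  assumes "graph_iso G H" and wf: "parcs G \<subseteq> pverts G \<times> pverts G"
  obtains f where "bij_betw f (pverts G) (pverts H)"
    and "\<And>u v. u \<in> pverts G \<Longrightarrow> v \<in> pverts G \<Longrightarrow> (u, v) \<in> parcs G \<longleftrightarrow> (f u, f v) \<in> parcs H"
proof -
  obtain h where h: "pre_digraph.digraph_isomorphism (with_proj G) h"
    and app: "with_proj H = app_iso h (with_proj G)"
    using assms(1) by (auto simp: graph_iso_def digraph_iso_def)
  let ?f = "iso_verts h"
  have inj: "inj_on ?f (pverts G)"
    using h by (simp add: pre_digraph.digraph_isomorphism_def)
  have "pverts H = ?f ` pverts G" "parcs H = iso_arcs h ` parcs G" "iso_tail h = fst" "iso_head h = snd"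
    using arg_cong[OF app, of verts] arg_cong[OF app, of arcs] arg_cong[OF app, of tail]
      arg_cong[OF app, of head] by simp_all
  note H = this
  have arc: "iso_arcs h (u, v) = (?f u, ?f v)" if "(u, v) \<in> parcs G" for u v
    using h that by (fastforce simp: pre_digraph.digraph_isomorphism_def H prod_eq_iff)
  have "(u, v) \<in> parcs G \<longleftrightarrow> (?f u, ?f v) \<in> parcs H" if uv: "u \<in> pverts G" "v \<in> pverts G" for u v
  proof
    assume "(u, v) \<in> parcs G"
    thus "(?f u, ?f v) \<in> parcs H" unfolding H(2) using arc by (metis imageI)
  next
    assume "(?f u, ?f v) \<in> parcs H"
    then obtain x y where xy: "(x, y) \<in> parcs G" "?f x = ?f u" "?f y = ?f v"
      using arc unfolding H(2) by force
    hence "x = u" "y = v" using inj uv wf by (auto dest: inj_onD)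
    thus "(u, v) \<in> parcs G" using xy by simp
  qed
  moreover have "bij_betw ?f (pverts G) (pverts H)"
    using inj H(1) by (simp add: bij_betw_def)
  ultimately show ?thesis using that by blast
qed

lemma graph_isoI:
  assumes G: "pair_wf_digraph G" and f: "bij_betw f (pverts G) (pverts H)"
    and H: "parcs H \<subseteq> pverts H \<times> pverts H"
    and arcs: "\<And>u v. u \<in> pverts G \<Longrightarrow> v \<in> pverts G \<Longrightarrow> (u, v) \<in> parcs G \<longleftrightarrow> (f u, f v) \<in> parcs H"
  shows "graph_iso G H"
proof -
  interpret pair_wf_digraph G by fact
  have wf: "parcs G \<subseteq> pverts G \<times> pverts G"
    using arc_fst_in_verts arc_snd_in_verts by force
  define h where "h = \<lparr>iso_verts = f, iso_arcs = map_prod f f, iso_head = snd, iso_tail = fst\<rparr>"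
  have inj: "inj_on f (pverts G)" using f by (simp add: bij_betw_def)
  hence "inj_on (map_prod f f) (pverts G \<times> pverts G)" by (simp add: map_prod_inj_on)
  hence "inj_on (map_prod f f) (parcs G)" using wf by (rule inj_on_subset)
  hence "pre_digraph.digraph_isomorphism (with_proj G) h"
    using inj wf_digraph_axioms by (auto simp: pre_digraph.digraph_isomorphism_def h_def)
  moreover have "parcs H = map_prod f f ` parcs G"
  proof
    show "map_prod f f ` parcs G \<subseteq> parcs H" using arcs wf by auto
    show "parcs H \<subseteq> map_prod f f ` parcs G"
    proof (rule subrelI)
      fix x y assume xy: "(x, y) \<in> parcs H"
      then obtain u v where "u \<in> pverts G" "v \<in> pverts G" "x = f u" "y = f v"
        using H f unfolding bij_betw_def by blast
      thus "(x, y) \<in> map_prod f f ` parcs G" using arcs xy by force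
    qed
  qed
  hence "with_proj H = app_iso h (with_proj G)"
    using f by (simp add: with_proj_def app_iso_def h_def bij_betw_def)
  ultimately show ?thesis by (auto simp: graph_iso_def digraph_iso_def)
qed

section \<open>From chords of a circle to chord diagrams\<close>

lemma sphere_angle:
  assumes "p \<in> sphere z r" "0 < r"
  shows "\<exists>\<theta>. 0 \<le> \<theta> \<and> \<theta> < 2 * pi \<and> p = z + r *\<^sub>R cis \<theta>"
proof -
  have "cmod (p - z) = r" using assms by (simp add: dist_norm norm_minus_commute)
  hence "p - z = of_real r * exp (\<i> * of_real (Arg2pi (p - z)))"
    using Arg2pi_eq[of "p - z"] by simp
  hence "p = z + r *\<^sub>R cis (Arg2pi (p - z))"
    by (simp add: cis_conv_exp scaleR_conv_of_real algebra_simps)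
  thus ?thesis using Arg2pi_ge_0 Arg2pi_lt_2pi by blast
qed

text \<open>Chords of the circle may share an end and then meet there, whereas the ends in a chord
  diagram are distinct. Shared ends are therefore pulled apart so that their chords cross.\<close>

lemma circle_chords_represented:
  assumes "finite S" "0 < r" and chords: "\<And>c. c \<in> S \<Longrightarrow> circle_chord z r c"
  shows "\<exists>l u. represents S (\<lambda>c d. c \<inter> d \<noteq> {}) l u"
proof -
  let ?F = "\<lambda>\<theta>. z + r *\<^sub>R cis \<theta>"
  have "\<exists>a b. 0 \<le> a \<and> a < b \<and> b < 2 * pi \<and> c = closed_segment (?F a) (?F b)" if "c \<in> S" for c
  proof -
    obtain p q where pq: "p \<in> sphere z r" "q \<in> sphere z r" "p \<noteq> q" "c = closed_segment p q"
      using chords[OF \<open>c \<in> S\<close>] by (auto simp: circle_chord_def)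
    obtain s t where st: "0 \<le> s" "s < 2 * pi" "p = ?F s" "0 \<le> t" "t < 2 * pi" "q = ?F t"
      using sphere_angle[OF pq(1) assms(2)] sphere_angle[OF pq(2) assms(2)] by blast
    consider "s < t" | "t < s" using pq(3) st by fastforce
    thus ?thesis
    proof cases
      case 1
      thus ?thesis using st pq(4) by blast
    next
      case 2
      thus ?thesis using st pq(4) closed_segment_commute by metis
    qed
  qed
  then obtain a b where ab: "\<And>c. c \<in> S \<Longrightarrow> 0 \<le> a c \<and> a c < b c \<and> b c < 2 * pi \<and>
      c = closed_segment (?F (a c)) (?F (b c))"
    by metis
  define P where "P = a ` S \<union> b ` S"
  have "finite P" using assms(1) by (simp add: P_def)
  from finite_gap[OF this] obtain e where e: "e > 0"
    and gap: "\<And>x y. x \<in> P \<Longrightarrow> y \<in> P \<Longrightarrow> x \<noteq> y \<Longrightarrow> x + 10 * e < y \<or> y + 10 * e < x"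
    by blast
  have less: "x + e * s < y + e * t \<longleftrightarrow> x < y \<or> x = y \<and> s < t"
    if xy: "x \<in> P" "y \<in> P" and st: "0 \<le> s" "s < 2" "0 \<le> t" "t < 2" for x y s t
  proof -
    have *: "0 \<le> e * s" "e * s < e * 2" "0 \<le> e * t" "e * t < e * 2"
      using st e by simp_all
    consider "x = y" | "x + 10 * e < y" | "y + 10 * e < x" using gap xy by blast
    thus ?thesis
    proof cases
      case 1
      thus ?thesis using e by simp
    next
      case 2
      hence "x + e * s < y + e * t" "x < y" using * by linarith+
      thus ?thesis by simp
    next
      case 3
      hence "\<not> x + e * s < y + e * t" "\<not> x < y" "x \<noteq> y" using * by linarith+
      thus ?thesis by simp
    qed
  qed
  \<comment> \<open>Among chords with a common end, the order by the other end makes them cross. Division by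
    \<open>8 > 2 * pi\<close> keeps left ends before right ends.\<close>
  define l where "l c = a c + e * (b c / 8)" for c
  define u where "u c = b c + e * (1 + a c / 8)" for c
  have P: "a c \<in> P" "b c \<in> P" if "c \<in> S" for c using that by (auto simp: P_def)
  have bounds: "0 \<le> a c / 8" "a c / 8 < 1" "0 \<le> b c / 8" "b c / 8 < 1" if "c \<in> S" for c
    using ab[OF that] pi_less_4 by auto
  have cmp: "l c < l d \<longleftrightarrow> a c < a d \<or> a c = a d \<and> b c < b d"
    "u c < u d \<longleftrightarrow> b c < b d \<or> b c = b d \<and> a c < a d"
    "l c < u d \<longleftrightarrow> a c \<le> b d" "u d < l c \<longleftrightarrow> b d < a c" if "c \<in> S" "d \<in> S" for c d
    using bounds[OF that(1)] bounds[OF that(2)] P[OF that(1)] P[OF that(2)]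
    unfolding l_def u_def by (subst less; auto)+
  have neq: "a c \<noteq> a d \<or> b c \<noteq> b d" if "c \<in> S" "d \<in> S" "c \<noteq> d" for c d
    using ab[OF that(1)] ab[OF that(2)] that(3) by metis
  have "chord_diagram S l u"
    unfolding chord_diagram_iff
  proof (intro ballI conjI impI)
    fix c assume c: "c \<in> S"
    show "l c < u c" using cmp(3)[OF c c] ab[OF c] by simp
    fix d assume d: "d \<in> S"
    show "l c \<noteq> u d" using cmp(3,4)[OF c d] by linarith
    assume "c \<noteq> d"
    thus "l c \<noteq> l d" "u c \<noteq> u d"
      using cmp(1,2)[OF c d] cmp(1,2)[OF d c] neq[OF c d] by linarith+
  qed
  moreover have "c \<inter> d \<noteq> {} \<longleftrightarrow> crosses l u c d" if c: "c \<in> S" and d: "d \<in> S" and "c \<noteq> d" for c d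
  proof -
    have crosses: "crosses l u c d \<longleftrightarrow> a c \<le> a d \<and> a d \<le> b c \<and> b c \<le> b d \<or> a d \<le> a c \<and> a c \<le> b d \<and> b d \<le> b c"
      using neq[OF c d \<open>c \<noteq> d\<close>] unfolding crosses_def cmp[OF c d] cmp[OF d c] by linarith
    have seg: "c = closed_segment (?F (a c)) (?F (b c))" "d = closed_segment (?F (a d)) (?F (b d))"
      using ab c d by blast+
    show ?thesis
    proof (cases "{a c, b c} \<inter> {a d, b d} = {}")
      case True
      have ne: "a c \<noteq> a d" "a c \<noteq> b d" "b c \<noteq> a d" "b c \<noteq> b d" using True by auto
      have "closed_segment (?F (a c)) (?F (b c)) \<inter> closed_segment (?F (a d)) (?F (b d)) \<noteq> {} \<longleftrightarrow>
        a c < a d \<and> a d < b c \<and> b c < b d \<or> a d < a c \<and> a c < b d \<and> b d < b c"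
        using ab[OF c] ab[OF d] assms(2) ne
        by (intro segments_meet_iff[where f = ?F] convex_side_circle) auto
      thus ?thesis unfolding crosses using seg ne by (metis order_le_less)
    next
      case False
      then obtain t where "t \<in> {a c, b c}" "t \<in> {a d, b d}" by blast
      hence "?F t \<in> c" "?F t \<in> d" using seg by (metis ends_in_segment insertE singletonD)+
      moreover have "crosses l u c d"
        unfolding crosses using False ab[OF c] ab[OF d] by auto
      ultimately show ?thesis by blast
    qed
  qed
  ultimately show ?thesis unfolding represents_def by blast
qed

lemma represents_reindex:
  assumes "represents S E l r" and f: "bij_betw f V S"
    and E: "\<And>u v. u \<in> V \<Longrightarrow> v \<in> V \<Longrightarrow> u \<noteq> v \<Longrightarrow> E' u v \<longleftrightarrow> E (f u) (f v)"
  shows "represents V E' (l \<circ> f) (r \<circ> f)"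
proof -
  have S: "f v \<in> S" if "v \<in> V" for v using f that by (auto simp: bij_betw_def)
  have inj: "f u \<noteq> f v" if "u \<in> V" "v \<in> V" "u \<noteq> v" for u v
    using f that by (auto simp: bij_betw_def dest: inj_onD)
  have dia: "chord_diagram S l r" using assms(1) by (simp add: represents_def)
  have "chord_diagram V (l \<circ> f) (r \<circ> f)"
  proof -
    have "l (f v) < r (f v)" if "v \<in> V" for v
      using dia S[OF that] by (simp add: chord_diagram_iff)
    thus ?thesis
      unfolding chord_diagram_iff comp_def using chord_diagramD(2-)[OF dia] S inj by simp
  qed
  moreover have "E (f u) (f v) \<longleftrightarrow> crosses l r (f u) (f v)" if "u \<in> V" "v \<in> V" "u \<noteq> v" for u v
    using assms(1) S inj that by (simp add: represents_def)
  ultimately show ?thesis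
    using E by (simp add: represents_def crosses_def)
qed

lemma circle_graph_represented:
  assumes "pair_graph G" "circle_graph G"
  shows "\<exists>l r. represents (pverts G) (\<lambda>u v. (u, v) \<in> parcs G) l r"
proof -
  interpret pair_graph G by fact
  obtain z r S where S: "0 < r" "finite S" "\<forall>c\<in>S. circle_chord z r c" "graph_iso G (intersection_graph S)"
    using assms(2) by (auto simp: circle_graph_def)
  have "parcs G \<subseteq> pverts G \<times> pverts G"
    using arc_fst_in_verts arc_snd_in_verts by force
  then obtain f where f: "bij_betw f (pverts G) S"
    "\<And>u v. u \<in> pverts G \<Longrightarrow> v \<in> pverts G \<Longrightarrow> (u, v) \<in> parcs G \<longleftrightarrow> (f u, f v) \<in> parcs (intersection_graph S)"
    using graph_isoD[OF S(4)] by (auto simp: intersection_graph_def)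
  obtain l u where "represents S (\<lambda>c d. c \<inter> d \<noteq> {}) l u"
    using circle_chords_represented[OF S(2,1)] S(3) by blast
  hence "represents (pverts G) (\<lambda>u v. (u, v) \<in> parcs G) (l \<circ> f) (u \<circ> f)"
  proof (rule represents_reindex[OF _ f(1)])
    fix u v assume uv: "u \<in> pverts G" "v \<in> pverts G" "u \<noteq> v"
    hence "f u \<in> S" "f v \<in> S" "f u \<noteq> f v" using f(1) by (auto simp: bij_betw_def dest: inj_onD)
    thus "(u, v) \<in> parcs G \<longleftrightarrow> f u \<inter> f v \<noteq> {}"
      using f(2)[OF uv(1,2)] by (simp add: intersection_graph_def)
  qed
  thus ?thesis by blast
qed

section \<open>From cuts to permutations and polygons\<close>

lemma cuttable_rotated:
  assumes "cuttable V E k" "finite V" "0 < k"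
  obtains l r X t where "represents V E l r" "finite X" "card X = k" "separates X V l r"
    and "t \<in> X" "\<And>x. x \<in> X \<Longrightarrow> t \<le> x" "\<And>v. v \<in> V \<Longrightarrow> t < l v"
proof -
  obtain l r X where rep: "represents V E l r" and X: "finite X" "card X = k" "separates X V l r"
    using assms(1) by (auto simp: cuttable_def)
  \<comment> \<open>With a cut as origin no arc between consecutive cuts wraps around; everything
    beyond the last cut belongs to the last arc.\<close>
  define t where "t = Min X"
  have t: "t \<in> X" using X assms(3) by (auto simp: t_def intro!: Min_in)
  obtain M l' r' where *: "represents V E l' r'"
    "\<And>x. x \<in> X \<Longrightarrow> t \<le> turn t M x" "\<And>x y. x \<in> X \<Longrightarrow> y \<in> X \<Longrightarrow> turn t M x = turn t M y \<longleftrightarrow> x = y"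
    "\<And>v. v \<in> V \<Longrightarrow> t \<le> l' v \<and> {l' v, r' v} = {turn t M (l v), turn t M (r v)}"
    "separates X V l r \<Longrightarrow> separates (turn t M ` X) V l' r'"
    using rotate[OF rep assms(2) X(1), of t] by metis
  note sep = *(5)[OF X(3)]
  have "turn t M t = t" by (simp add: turn_def)
  hence tX: "t \<in> turn t M ` X" using t by (metis imageI)
  have "inj_on (turn t M) X" using *(3) by (auto intro: inj_onI)
  hence "card (turn t M ` X) = k" using X by (simp add: card_image)
  moreover have "t < l' v" if "v \<in> V" for v
  proof -
    have "t \<noteq> l' v" using tX sep that by (auto simp: separates_def)
    thus ?thesis using *(4)[OF that] by simp
  qed
  moreover have "t \<le> x" if "x \<in> turn t M ` X" for x using *(2) that by auto
  ultimately show ?thesis using that[OF *(1) _ _ sep tX] X(1) by blast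
qed


lemma bij_betw_rank:
  fixes h :: "'a \<Rightarrow> real"
  assumes "finite V" "inj_on h V"
  defines "below \<equiv> \<lambda>v. card {w \<in> V. h w < h v}"
  shows "bij_betw below V {..<card V}"
    and "\<And>u v. u \<in> V \<Longrightarrow> v \<in> V \<Longrightarrow> below u < below v \<longleftrightarrow> h u < h v"
proof -
  have mono: "below u < below v" if "u \<in> V" "v \<in> V" "h u < h v" for u v
    unfolding below_def using that assms(1) by (intro psubset_card_mono) auto
  show iff: "below u < below v \<longleftrightarrow> h u < h v" if "u \<in> V" "v \<in> V" for u v
    using mono[OF that] mono[OF that(2,1)] assms(2) that
    by (metis inj_onD not_less_iff_gr_or_eq)
  have "inj_on below V"
    using iff assms(2) by (metis inj_on_def linorder_neqE_linordered_idom order_less_irrefl)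
  moreover have "below v < card V" if "v \<in> V" for v
    unfolding below_def using that assms(1) by (intro psubset_card_mono) auto
  ultimately have "inj_on below V \<and> below ` V \<subseteq> {..<card V} \<and> card (below ` V) = card {..<card V}"
    by (auto simp: card_image)
  thus "bij_betw below V {..<card V}"
    unfolding bij_betw_def by (metis card_subset_eq finite_lessThan)
qed

text \<open>Two cuts leave two arcs, and every chord has one end on each: this is a permutation
  diagram.\<close>

lemma permutation_graph_if_cuttable:
  assumes "pair_graph G" and cut: "cuttable (pverts G) (\<lambda>u v. (u, v) \<in> parcs G) 2"
  shows "permutation_graph G"
proof -
  interpret pair_graph G by fact
  define V where "V = pverts G"
  have fin: "finite V" using pair_finite_verts by (simp add: V_def)
  obtain l r X t where rep: "represents V (\<lambda>u v. (u, v) \<in> parcs G) l r" and X: "finite X" "card X = 2"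
    "separates X V l r" "t \<in> X" and t: "\<And>v. v \<in> V \<Longrightarrow> t < l v"
    using cuttable_rotated[of V _ 2] cut fin unfolding V_def by (metis zero_less_numeral)
  have dia: "chord_diagram V l r" using rep by (simp add: represents_def)
  obtain m where m: "X = {t, m}"
    using X by (metis card_2_iff insert_commute insertE singletonD)
  have split: "l v < m \<and> m < r v" if "v \<in> V" for v
  proof -
    obtain x where "x \<in> X" "l v < x" "x < r v" using X(3) \<open>v \<in> V\<close> unfolding separates_def by blast
    thus ?thesis using t[OF that] m by auto
  qed
  have cross: "crosses l r u v \<longleftrightarrow> l u < l v \<and> r u < r v \<or> l v < l u \<and> r v < r u" if "u \<in> V" "v \<in> V" for u v
    using split[OF that(1)] split[OF that(2)] by (auto simp: crosses_def)
  define n where "n = card V"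
  define \<rho> where "\<rho> = (\<lambda>v. card {w \<in> V. l w < l v})"
  \<comment> \<open>Crossing chords have left and right ends in the same order, whereas an inversion
    reverses the order; hence the negated right ends.\<close>
  define \<tau> where "\<tau> = (\<lambda>v. card {w \<in> V. - r w < - r v})"
  have inj: "inj_on l V" "inj_on (\<lambda>v. - r v) V"
    using dia by (auto simp: chord_diagram_def inj_on_def)
  have \<rho>: "bij_betw \<rho> V {..<n}" "\<And>u v. u \<in> V \<Longrightarrow> v \<in> V \<Longrightarrow> \<rho> u < \<rho> v \<longleftrightarrow> l u < l v"
    using bij_betw_rank[OF fin inj(1)] by (simp_all add: \<rho>_def n_def)
  have \<tau>: "bij_betw \<tau> V {..<n}" "\<And>u v. u \<in> V \<Longrightarrow> v \<in> V \<Longrightarrow> \<tau> u < \<tau> v \<longleftrightarrow> r v < r u"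
    using bij_betw_rank[OF fin inj(2)] by (simp_all add: \<tau>_def n_def)
  define p where "p i = (if i < n then \<tau> (inv_into V \<rho> i) else i)" for i
  have p: "p (\<rho> v) = \<tau> v" "\<rho> v < n" if "v \<in> V" for v
    using \<rho>(1) that by (auto simp: p_def bij_betw_def inv_into_f_f)
  have "bij_betw (\<tau> \<circ> inv_into V \<rho>) {..<n} {..<n}"
    using bij_betw_trans[OF bij_betw_inv_into[OF \<rho>(1)] \<tau>(1)] .
  hence "bij_betw p {..<n} {..<n}"
    by (rule bij_betw_cong[THEN iffD1, rotated]) (simp add: p_def)
  hence "p permutes {..<n}" by (rule bij_imp_permutes) (simp add: p_def)
  moreover have "graph_iso G (inversion_graph n p)"
  proof (rule graph_isoI[where f = \<rho>])
    show "pair_wf_digraph G" by (rule pair_wf_digraph_axioms)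
    show "bij_betw \<rho> (pverts G) (pverts (inversion_graph n p))"
      using \<rho>(1) by (simp add: V_def inversion_graph_def)
    show "parcs (inversion_graph n p) \<subseteq> pverts (inversion_graph n p) \<times> pverts (inversion_graph n p)"
      by (auto simp: inversion_graph_def)
    fix u v assume "u \<in> pverts G" "v \<in> pverts G"
    hence uv: "u \<in> V" "v \<in> V" by (simp_all add: V_def)
    have "(u, v) \<in> parcs G \<longleftrightarrow> crosses l r u v"
    proof (cases "u = v")
      case True
      thus ?thesis using pair_no_loops[of "(u, v)"] by (auto simp: crosses_def)
    qed (use rep uv in \<open>simp add: represents_def\<close>)
    thus "(u, v) \<in> parcs G \<longleftrightarrow> (\<rho> u, \<rho> v) \<in> parcs (inversion_graph n p)"
      using uv cross \<rho>(2) \<tau>(2) p by (simp add: inversion_graph_def)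
  qed
  ultimately show ?thesis by (auto simp: permutation_graph_def)
qed

text \<open>Each arc between consecutive cuts is mapped monotonically into the interior of one side,
  so the order of the ends is kept and every chord joins two sides.\<close>

lemma polygon_graph_if_cuttable:
  assumes "pair_graph G" and k: "3 \<le> k" and cut: "cuttable (pverts G) (\<lambda>u v. (u, v) \<in> parcs G) k"
  shows "polygon_graph k G"
proof -
  interpret pair_graph G by fact
  define V where "V = pverts G"
  have fin: "finite V" using pair_finite_verts by (simp add: V_def)
  obtain l r X t where rep: "represents V (\<lambda>u v. (u, v) \<in> parcs G) l r" and X: "finite X" "card X = k"
    "separates X V l r" "t \<in> X" and t: "\<And>v. v \<in> V \<Longrightarrow> t < l v"
    using cuttable_rotated[of V _ k] cut fin k unfolding V_def
    by (metis not_numeral_le_zero gr0I)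
  have dia: "chord_diagram V l r" using rep by (simp add: represents_def)
  note D = chord_diagramD[OF dia]
  define before where "before x = {y \<in> X. y < x}" for x
  define s where "s x = 1 / 2 + arctan x / pi" for x
  have s01: "0 < s x" "s x < 1" for x
    using arctan_bounded[of x] by (simp_all add: s_def field_simps)
  have s_less: "s x < s y" if "x < y" for x y
    using arctan_monotone[OF that] by (simp add: s_def divide_strict_right_mono)
  \<comment> \<open>The number of cuts passed is the integer part and selects the side;
    \<open>s\<close> squeezes the line into \<open>(0, 1)\<close>. The origin \<open>t\<close>
    precedes all ends, hence \<open>- 1\<close>.\<close>
  define pos where "pos x = real (card (before x)) - 1 + s x" for x
  have floor_pos: "\<lfloor>pos x\<rfloor> = int (card (before x)) - 1" for x
    using s01[of x] by (intro floor_unique) (auto simp: pos_def)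
  have nonint: "pos x \<notin> \<int>" for x
  proof
    assume "pos x \<in> \<int>"
    hence "pos x = of_int \<lfloor>pos x\<rfloor>" by (metis Ints_cases floor_of_int)
    thus False using s01[of x] unfolding floor_pos by (simp add: pos_def)
  qed
  have pos_less: "pos x < pos y" if "x < y" for x y
  proof -
    have "card (before x) \<le> card (before y)"
      using that X(1) by (intro card_mono) (auto simp: before_def)
    thus ?thesis using s_less[OF that] by (simp add: pos_def)
  qed
  hence pos_iff: "pos x < pos y \<longleftrightarrow> x < y" for x y by (metis linorder_neqE_linordered_idom order_less_asym)
  have pos_range: "0 < pos x" "pos x < real k" if "t < x" for x
  proof -
    have "card {t} \<le> card (before x)"
      using that X by (intro card_mono) (auto simp: before_def)
    thus "0 < pos x" using s01[of x] by (simp add: pos_def)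
    have "card (before x) \<le> k" using X by (auto simp: before_def intro: card_mono)
    thus "pos x < real k" using s01[of x] by (simp add: pos_def)
  qed
  define l' r' where "l' v = pos (l v)" and "r' v = pos (r v)" for v
  have rng: "0 < l' v" "l' v < r' v" "r' v < real k" "l' v < real k" "0 < r' v" if "v \<in> V" for v
    using pos_range[of "l v"] pos_range[of "r v"] D(1)[OF that that] t[OF that]
    by (simp_all add: l'_def r'_def pos_iff)
  have floors: "\<lfloor>l' v\<rfloor> \<noteq> \<lfloor>r' v\<rfloor>" if "v \<in> V" for v
  proof -
    obtain x where x: "x \<in> X" "l v < x" "x < r v"
      using X(3) \<open>v \<in> V\<close> unfolding separates_def by blast
    have "x \<in> before (r v)" "x \<notin> before (l v)" using x by (simp_all add: before_def)
    moreover have "before (l v) \<subseteq> before (r v)" using x by (force simp: before_def)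
    ultimately have "before (l v) \<subset> before (r v)" by blast
    moreover have "finite (before (r v))" using X(1) by (simp add: before_def)
    ultimately have "card (before (l v)) < card (before (r v))" by (simp add: psubset_card_mono)
    thus ?thesis by (simp add: l'_def r'_def floor_pos)
  qed
  let ?f = "boundary_point k"
  define chord where "chord v = closed_segment (?f (l' v)) (?f (r' v))" for v
  have convex: "convex_side ?f (l' v) (r' v) x"
    if "v \<in> V" "0 < x" "x < real k" "x \<notin> \<int>" "x \<noteq> l' v" "x \<noteq> r' v" for v x
    using that rng[OF that(1)] floors[OF that(1)] k
    by (intro convex_side_boundary_point) (auto simp: l'_def r'_def nonint)
  have off_line: "orient (?f (l' v)) (?f (r' v)) (?f x) \<noteq> 0"
    if "v \<in> V" "0 < x" "x < real k" "x \<notin> \<int>" "x \<noteq> l' v" "x \<noteq> r' v" for v x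
    using convex[OF that] that(5,6) unfolding convex_side_def by linarith
  have ends_ne: "?f (l' v) \<noteq> ?f (r' v)" if v: "v \<in> V" for v
  proof -
    \<comment> \<open>Any third boundary point would do: if the two ends coincided, its
      \<open>orient\<close> with respect to them would vanish. This one is on the first side before
      \<open>l' v\<close>.\<close>
    define x where "x = min (l' v) 1 / 2"
    have x: "0 < x" "x < l' v" "x < 1" using rng(1)[OF v] by (auto simp: x_def min_def)
    hence "x \<notin> \<int>" by (auto elim!: Ints_cases)
    hence "orient (?f (l' v)) (?f (r' v)) (?f x) \<noteq> 0"
      using off_line[OF v, of x] x rng[OF v] by auto
    thus ?thesis by (auto simp: orient_def)
  qed
  have ends_dist: "l' u \<noteq> l' v" "l' u \<noteq> r' v" "r' u \<noteq> l' v" "r' u \<noteq> r' v"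
    if "u \<in> V" "v \<in> V" "u \<noteq> v" for u v
    using D[OF that(1,2)] that(3) pos_iff unfolding l'_def r'_def by (metis order_less_irrefl linorder_neqE_linordered_idom)+
  have meet: "chord u \<inter> chord v \<noteq> {} \<longleftrightarrow> crosses l r u v" if uv: "u \<in> V" "v \<in> V" "u \<noteq> v" for u v
  proof -
    have "chord u \<inter> chord v \<noteq> {} \<longleftrightarrow>
      l' u < l' v \<and> l' v < r' u \<and> r' u < r' v \<or> l' v < l' u \<and> l' u < r' v \<and> r' v < r' u"
      unfolding chord_def
      using uv rng[OF uv(1)] rng[OF uv(2)] ends_dist[OF uv] ends_dist[OF uv(2,1)]
      by (intro segments_meet_iff[where f = ?f] convex) (auto simp: l'_def r'_def nonint)
    thus ?thesis by (simp add: crosses_def l'_def r'_def pos_iff)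
  qed
  have chord_ne: "chord u \<noteq> chord v" if uv: "u \<in> V" "v \<in> V" "u \<noteq> v" for u v
  proof
    assume "chord u = chord v"
    hence "{?f (l' u), ?f (r' u)} = {?f (l' v), ?f (r' v)}"
      by (simp add: chord_def)
    hence "?f (l' v) = ?f (l' u) \<or> ?f (l' v) = ?f (r' u)" by (auto simp: doubleton_eq_iff)
    hence "orient (?f (l' u)) (?f (r' u)) (?f (l' v)) = 0" by (auto simp: orient_def)
    thus False using off_line[of u "l' v"] uv rng[OF uv(2)] ends_dist[OF uv] nonint
      by (auto simp: l'_def)
  qed
  have "graph_iso G (intersection_graph (chord ` V))"
  proof (rule graph_isoI[where f = chord])
    show "pair_wf_digraph G" by (rule pair_wf_digraph_axioms)
    show "bij_betw chord (pverts G) (pverts (intersection_graph (chord ` V)))"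
      using chord_ne by (auto simp: bij_betw_def intersection_graph_def V_def intro!: inj_onI)
    show "parcs (intersection_graph (chord ` V)) \<subseteq>
      pverts (intersection_graph (chord ` V)) \<times> pverts (intersection_graph (chord ` V))"
      by (auto simp: intersection_graph_def)
    fix u v assume "u \<in> pverts G" "v \<in> pverts G"
    hence uv: "u \<in> V" "v \<in> V" by (simp_all add: V_def)
    show "(u, v) \<in> parcs G \<longleftrightarrow> (chord u, chord v) \<in> parcs (intersection_graph (chord ` V))"
    proof (cases "u = v")
      case True
      thus ?thesis using pair_no_loops[of "(u, v)"] by (auto simp: intersection_graph_def)
    next
      case False
      hence "(u, v) \<in> parcs G \<longleftrightarrow> crosses l r u v" using rep uv by (simp add: represents_def)
      thus ?thesis using meet[OF uv False] chord_ne[OF uv False] uv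
        by (simp add: intersection_graph_def)
    qed
  qed
  moreover have "polygon_chord (polygon k) (chord v)" if v: "v \<in> V" for v
  proof -
    have "side k (nat \<lfloor>x\<rfloor>) edge_of polygon k" "?f x \<in> side k (nat \<lfloor>x\<rfloor>)" "nat \<lfloor>x\<rfloor> < k"
      if "0 < x" "x < real k" for x
      using boundary_point_in_side[of k x] that k edges_of_polygon[OF k] by auto
    note sides = this
    have "nat \<lfloor>l' v\<rfloor> \<noteq> nat \<lfloor>r' v\<rfloor>" using floors[OF v] rng[OF v] by (simp add: nat_eq_iff)
    hence "side k (nat \<lfloor>l' v\<rfloor>) \<noteq> side k (nat \<lfloor>r' v\<rfloor>)"
      using side_eq_iff[OF k] sides(3) rng[OF v] by auto
    thus ?thesis
      unfolding polygon_chord_def chord_def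
      using sides[of "l' v"] sides[of "r' v"] rng[OF v] ends_ne[OF v] by blast
  qed
  ultimately have "convex_polygon k (polygon k) \<and> finite (chord ` V) \<and>
      (\<forall>c\<in>chord ` V. polygon_chord (polygon k) c) \<and> graph_iso G (intersection_graph (chord ` V))"
    using polygon_properties[OF k] fin by (auto simp: convex_polygon_def)
  thus ?thesis using k by (auto simp: polygon_graph_def)
qed

theorem theorem4:
  fixes G :: "'a pair_pre_digraph" and n :: nat
  assumes "pair_graph G" and "circle_graph G"
    and "n = card (pverts G)" and "n \<ge> 3"
  shows "int (polygon_number G) \<le> \<lceil>real n / 2\<rceil>"
proof -
  interpret pair_graph G by fact
  define k where "k = nat \<lceil>real n / 2\<rceil>"
  have ceil: "int k = \<lceil>real n / 2\<rceil>" by (simp add: k_def)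
  have "real n / 2 \<le> real k" using ceil le_of_int_ceiling[of "real n / 2"] by (metis of_int_of_nat_eq)
  \<comment> \<open>The hypothesis \<open>n \<ge> 3\<close> is what gives
    \<open>2 \<le> k\<close>.\<close>
  hence k: "card (pverts G) \<le> 2 * k" "2 \<le> k" using assms(3,4) by linarith+
  obtain l r where "represents (pverts G) (\<lambda>u v. (u, v) \<in> parcs G) l r"
    using circle_graph_represented[OF assms(1,2)] by blast
  hence cut: "cuttable (pverts G) (\<lambda>u v. (u, v) \<in> parcs G) k"
    using cuttable_if_card_le pair_finite_verts k by blast
  have "polygon_graph k G"
  proof (cases "k = 2")
    case True
    thus ?thesis using permutation_graph_if_cuttable[OF assms(1)] cut by (simp add: polygon_graph_def)
  next
    case False
    thus ?thesis using polygon_graph_if_cuttable[OF assms(1) _ cut] k(2) by simp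
  qed
  hence "polygon_number G \<le> k"
    unfolding polygon_number_def using k(2) by (intro Least_le) simp
  thus ?thesis using ceil by linarith
qed

end
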